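(* Let $3\le k<\ell$ be integers satisfying $\ell\not\equiv 0,\pm1\pmod k$ and $\gcd(k,\ell)>1$. Let $p$ be the smallest prime factor of $\frac{k}{\gcd(k,\ell)}$ and let $t$ be the smallest odd integer satisfying $t\ge\max(3,\gcd(k,\ell))$. Then \[\gamma(C^{k-}_\ell)\ge\max\left(\frac1p,\frac1t\right).\]
   Context: A $k$-uniform hypergraph $G$ has a finite vertex set $V(G)$ and an edge set $E(G)$ consisting of $k$-element subsets of $V(G)$. The codegree of a $(k-1)$-subset $S\subseteq V(G)$ is $|\{v\in V(G): S\cup\{v\}\in E(G)\}|$, where only $k$-sets $S\cup\{v\}$ count, and $\delta_{k-1}(G)$ is the minimum codegree over all $(k-1)$-subsets of $V(G)$. For a $k$-uniform hypergraph $F$, $\mathrm{ex}_{k-1}(n,F)$ is the largest value of $\delta_{k-1}(G)$ over $k$-uniform hypergraphs $G$ on $n$ vertices containing no copy of $F$ (as a not necessarily induced subhypergraph). The codegree Turán density of $F$ is $\gamma(F)=\lim_{n\to\infty}\mathrm{ex}_{k-1}(n,F)/n$ (this limit is known to exist). For $\ell\ge k+1$, the tight cycle $C^k_\ell$ is the $k$-uniform hypergraph on $\ell$ distinct vertices $v_1,\dots,v_\ell$ with edges $\{v_i,v_{i+1},\dots,v_{i+k-1}\}$ for all $i\in\{1,\dots,\ell\}$, indices modulo $\ell$. $C^{k-}_\ell$ is the hypergraph obtained from $C^k_\ell$ by removing a single edge. *)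

theory Defs
  imports Complex_Main "HOL-Computational_Algebra.Primes" "HOL-Number_Theory.Cong"
begin

text \<open>A hypergraph is a pair of a vertex set and an edge set.\<close>

type_synonym 'a hypergraph = "'a set \<times> 'a set set"

abbreviation verts :: "'a hypergraph \<Rightarrow> 'a set" where
  "verts G \<equiv> fst G"

abbreviation edges :: "'a hypergraph \<Rightarrow> 'a set set" where
  "edges G \<equiv> snd G"

definition uniform_hypergraph :: "nat \<Rightarrow> 'a hypergraph \<Rightarrow> bool" where
  "uniform_hypergraph k G \<longleftrightarrow>
     finite (verts G) \<and> (\<forall>e\<in>edges G. e \<subseteq> verts G \<and> card e = k)"

text \<open>If \<open>G\<close> is \<open>k\<close>-uniform and \<open>S\<close> has \<open>k - 1\<close> elements, then \<open>S \<union> {v} \<in> edges G\<close> already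
  forces \<open>v \<notin> S\<close>, so only \<open>k\<close>-element sets are counted.\<close>

definition codegree :: "'a hypergraph \<Rightarrow> 'a set \<Rightarrow> nat" where
  "codegree G S = card {v \<in> verts G. S \<union> {v} \<in> edges G}"

text \<open>The value is meaningful only if \<open>G\<close> has at least \<open>k - 1\<close> vertices; smaller vertex sets do
  not affect the density below, which is a limit.\<close>

definition min_codegree :: "nat \<Rightarrow> 'a hypergraph \<Rightarrow> nat" where
  "min_codegree k G = Min (codegree G ` {S. S \<subseteq> verts G \<and> card S = k - 1})"

definition contains_copy :: "'a hypergraph \<Rightarrow> 'b hypergraph \<Rightarrow> bool" where
  "contains_copy G F \<longleftrightarrow>
     (\<exists>f. inj_on f (verts F) \<and> f ` verts F \<subseteq> verts G \<and> (\<forall>e\<in>edges F. f ` e \<in> edges G))"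

text \<open>Every finite hypergraph is isomorphic to one whose vertices are natural numbers, so taking
  the host hypergraphs over \<open>nat\<close> loses nothing.\<close>

definition codegree_ex :: "nat \<Rightarrow> nat \<Rightarrow> 'b hypergraph \<Rightarrow> nat" where
  "codegree_ex k n F =
     Max {min_codegree k G | G :: nat hypergraph.
            uniform_hypergraph k G \<and> card (verts G) = n \<and> \<not> contains_copy G F}"

definition codegree_turan_density :: "nat \<Rightarrow> 'b hypergraph \<Rightarrow> real" where
  "codegree_turan_density k F = lim (\<lambda>n. real (codegree_ex k n F) / real n)"

text \<open>The vertices of the tight cycle are numbered from \<open>0\<close> to \<open>l - 1\<close>.\<close>

definition tight_edge :: "nat \<Rightarrow> nat \<Rightarrow> nat \<Rightarrow> nat set" where
  "tight_edge k l i = (\<lambda>j. (i + j) mod l) ` {..<k}"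

definition tight_cycle :: "nat \<Rightarrow> nat \<Rightarrow> nat hypergraph" where
  "tight_cycle k l = ({..<l}, tight_edge k l ` {..<l})"

text \<open>Rotations act transitively on the edges of the tight cycle, so up to isomorphism it does not
  matter which edge is removed.\<close>

definition tight_cycle_minus :: "nat \<Rightarrow> nat \<Rightarrow> nat hypergraph" where
  "tight_cycle_minus k l =
     (verts (tight_cycle k l), edges (tight_cycle k l) - {tight_edge k l 0})"

end

theory Submission
  imports Defs "HOL-Library.FuncSet" "HOL-Library.Multiset" "HOL-Real_Asymp.Real_Asymp"
begin

text \<open>
  \<^bold>\<open>The limit exists.\<close>  The density is defined as a limit, so convergence has to be established
  first.  In a host on \<open>m\<close> vertices choose \<open>n\<close> vertices at random.  An exponential moment bound shows
  that all relative codegrees survive up to a small error, except with probability less than one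
  (\<open>exists_good_sample\<close>).  Hence \<open>ex m / m \<le> ex n / n + e\<close> whenever \<open>n\<close> is large and \<open>m\<close> is much larger
  than \<open>n\<close>, which forces convergence.

  \<^bold>\<open>Coloured hosts.\<close>  Colour the vertices with \<open>q\<close> colours in almost equal parts and let the
  colour multiset of a \<open>k\<close>-set decide whether it is an edge.  If every colour multiset of size
  \<open>k - 1\<close> has an allowed extension, then all codegrees are at least \<open>n / q\<close> up to a constant
  (\<open>density_ge_of_colour_pattern\<close>).  A copy of the cycle minus an edge becomes an \<open>l\<close>-periodic sequence of
  colours \<open>Q\<close> whose windows of length \<open>k\<close> starting at \<open>1, \<dots>, l - 1\<close> are allowed.  Put \<open>g = gcd k l\<close>
  and \<open>r = k / g\<close>.  If \<open>Q i = Q (i + k)\<close> holds whenever two consecutive windows are both present, then \<open>Q\<close> has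
  period \<open>g\<close>: the steps by \<open>k\<close> form \<open>g\<close> closed cycles, the missing edge destroys two
  steps at consecutive positions, and since \<open>g > 1\<close> these lie on different cycles.
  Then every window is an \<open>r\<close>-fold multiple of a multiset of size \<open>g\<close>.

  \<^bold>\<open>The bound \<open>1 / p\<close>.\<close>  Allow the colour sums that are \<open>1\<close> modulo \<open>p\<close>.  Consecutive
  windows have equal sums, so \<open>Q\<close> has period \<open>g\<close> and the sum of a window is a multiple of \<open>r\<close>, hence of \<open>p\<close>.

  \<^bold>\<open>The bound \<open>1 / t\<close>.\<close>  It is needed only for \<open>p > t\<close>, and then \<open>r \<ge> 5\<close>.  Start from the sums that
  are \<open>1\<close> modulo \<open>t\<close> but forbid all \<open>r\<close>-fold multiples.  The only multisets of size \<open>k - 1\<close> that lose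
  their extension are those of the form \<open>r M - c\<close> with \<open>c\<close> in \<open>M\<close>; they receive the new extension
  \<open>r M - c + c'\<close>.  The colour \<open>c'\<close> is \<open>c + 1\<close>, or \<open>c + 2\<close> if \<open>c + 1\<close> is the only colour missing from \<open>M\<close>.
  Some colour is missing: \<open>M\<close> has size \<open>g \<le> t\<close>, and if it contained every colour, its sum would be
  divisible by the odd number \<open>t\<close>.  The decisive point is that the new multisets are isolated from each other: a
  walk through allowed windows that visits \<open>r M - c + c'\<close> never leaves this multiset and the
  unrepaired multisets next to it (\<open>cluster_step\<close>).  Near \<open>r M - c + c'\<close> colours change only from \<open>u\<close> to
  \<open>u - (c' - c)\<close> and back, with \<open>u \<noteq> c'\<close> in \<open>M\<close>.  Cutting the cycle of colours at \<open>c'\<close> and at a missing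
  colour gives a set \<open>W\<close> of colours that contains \<open>c'\<close> but not \<open>c\<close> and that no such change crosses
  (\<open>exists_cut\<close>).  So membership in \<open>W\<close> has period \<open>g\<close> along \<open>Q\<close>, and the number of
  elements of \<open>r M - c + c'\<close> in \<open>W\<close> is divisible by \<open>r\<close>; but it is \<open>1\<close> modulo \<open>r\<close>.
\<close>

section \<open>Random samples keep codegrees\<close>

text \<open>The limit is the infimum of all eventual upper bounds: every late term is at most \<open>e\<close> above it
  by the choice of an eventual bound, and at most \<open>e\<close> below it because the term plus \<open>e\<close> is itself an
  eventual bound.\<close>

lemma convergent_of_eventually_almost_decreasing:
  fixes a :: "nat \<Rightarrow> real"
  assumes bdd: "\<And>n. a n \<ge> 0"
    and dec: "\<And>e. e > 0 \<Longrightarrow> \<exists>N. \<forall>n\<ge>N. \<exists>M. \<forall>m\<ge>M. a m \<le> a n + e"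
  shows "convergent a"
proof -
  define U where "U = {x. \<exists>M. \<forall>m\<ge>M. a m \<le> x}"
  have lb: "0 \<le> x" if "x \<in> U" for x
    using that bdd unfolding U_def by (auto intro: order.trans)
  have bb: "bdd_below U" using lb by (meson bdd_belowI)
  have ne: "U \<noteq> {}" using dec[of 1] unfolding U_def by fastforce
  have "a \<longlonglongrightarrow> Inf U"
  proof (rule LIMSEQ_I)
    fix e :: real assume e: "e > 0"
    obtain x where x: "x \<in> U" "x < Inf U + e"
      using cInf_lessD[OF ne, of "Inf U + e"] e by auto
    then obtain M where M: "\<And>m. m \<ge> M \<Longrightarrow> a m \<le> x" unfolding U_def by auto
    obtain N where N: "\<And>n. n \<ge> N \<Longrightarrow> \<exists>M. \<forall>m\<ge>M. a m \<le> a n + e/2"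
      using dec[of "e/2"] e by auto
    have "norm (a n - Inf U) < e" if n: "n \<ge> max M N" for n
    proof -
      have "a n + e/2 \<in> U" using N n unfolding U_def by simp
      then have "Inf U \<le> a n + e/2" using bb by (rule cInf_lower)
      moreover have "a n \<le> x" using M n by simp
      ultimately show ?thesis using x e by (simp add: abs_less_iff)
    qed
    then show "\<exists>no. \<forall>n\<ge>no. norm (a n - Inf U) < e" by blast
  qed
  then show ?thesis by (rule convergentI)
qed

text \<open>Exponential moment bound for a sample \<open>f\<close> with replacement.  Once the values of \<open>f\<close> on
  \<open>T\<close> are fixed, the other coordinates are independent, so the sum over \<open>f\<close> factorises, and each
  factor is at most \<open>card V - d (1 - exp (- s))\<close> by the codegree assumption.\<close>

lemma sum_exp_hits_le:
  fixes V :: "'a set" and E :: "'a set set" and s :: real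
  assumes I: "finite I" "T \<subseteq> I" and V: "finite V"
    and deg: "\<And>S. S \<subseteq> V \<Longrightarrow> card S = card T \<Longrightarrow> d \<le> card {v \<in> V. S \<union> {v} \<in> E}"
    and s: "s \<ge> 0"
    and T: "card T \<le> card V"
  shows "(\<Sum>f\<in>{f \<in> I \<rightarrow>\<^sub>E V. inj_on f T}. exp (- s * card {i \<in> I - T. f ` T \<union> {f i} \<in> E}))
           \<le> real (card V) ^ card T * (card V - d * (1 - exp (- s))) ^ card (I - T)"
proof -
  define w where "w S v = (if S \<union> {v} \<in> E then exp (- s) else 1)" for S v
  define B where "B h i = (if i \<in> T then {h i} else V)" for h :: "'b \<Rightarrow> 'a" and i
  have finT: "finite T" using I finite_subset by auto
  have finP: "finite (I \<rightarrow>\<^sub>E V)" by (intro finite_PiE) (use I V in auto)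
  have weight: "exp (- s * card {i \<in> I - T. f ` T \<union> {f i} \<in> E}) = (\<Prod>i\<in>I - T. w (f ` T) (f i))" for f
  proof -
    have "(\<Prod>i\<in>I - T. w (f ` T) (f i)) = exp (-s) ^ card {i \<in> I - T. f ` T \<union> {f i} \<in> E}"
      unfolding w_def using I(1) by (simp add: prod.If_cases Int_def)
    also have "\<dots> = exp (- s * card {i \<in> I - T. f ` T \<union> {f i} \<in> E})"
      by (simp add: exp_of_nat_mult[symmetric] mult.commute)
    finally show ?thesis by simp
  qed
  \<comment> \<open>The samples that agree with a fixed \<open>h\<close> on \<open>T\<close> form a product set, so sums of products over them factorise.\<close>
  have fibre: "{f \<in> {f \<in> I \<rightarrow>\<^sub>E V. inj_on f T}. restrict f T = h} = PiE I (B h)"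
    if h: "h \<in> T \<rightarrow>\<^sub>E V" "inj_on h T" for h
  proof (intro equalityI subsetI)
    fix f assume "f \<in> {f \<in> {f \<in> I \<rightarrow>\<^sub>E V. inj_on f T}. restrict f T = h}"
    then show "f \<in> PiE I (B h)" unfolding B_def by (auto simp: PiE_iff)
  next
    fix f assume f: "f \<in> PiE I (B h)"
    then have eq: "f i = h i" if "i \<in> T" for i using that I unfolding B_def PiE_iff by fastforce
    have "restrict f T = h" using eq h(1) by (auto simp: restrict_def fun_eq_iff PiE_iff extensional_def)
    moreover have "inj_on f T" using eq h(2) by (simp add: inj_on_def)
    moreover have "f \<in> I \<rightarrow>\<^sub>E V" using f h(1) eq unfolding B_def PiE_iff
      by (metis insert_iff singletonD)
    ultimately show "f \<in> {f \<in> {f \<in> I \<rightarrow>\<^sub>E V. inj_on f T}. restrict f T = h}" by simp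
  qed
  have inner: "(\<Sum>f\<in>PiE I (B h). \<Prod>i\<in>I - T. w (f ` T) (f i)) \<le> (card V - d * (1 - exp (- s))) ^ card (I - T)"
    if h: "h \<in> T \<rightarrow>\<^sub>E V" "inj_on h T" for h
  proof -
    have "(\<Sum>f\<in>PiE I (B h). \<Prod>i\<in>I - T. w (f ` T) (f i))
        = (\<Sum>f\<in>PiE I (B h). \<Prod>i\<in>I. if i \<in> T then 1 else w (h ` T) (f i))"
    proof (rule sum.cong[OF refl])
      fix f assume f: "f \<in> PiE I (B h)"
      then have "f i = h i" if "i \<in> T" for i using that I unfolding B_def PiE_iff by fastforce
      then have "f ` T = h ` T" by simp
      then show "(\<Prod>i\<in>I - T. w (f ` T) (f i)) = (\<Prod>i\<in>I. if i \<in> T then 1 else w (h ` T) (f i))"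
        using I by (intro prod.mono_neutral_cong_left) auto
    qed
    also have "\<dots> = (\<Prod>i\<in>I. \<Sum>v\<in>B h i. if i \<in> T then 1 else w (h ` T) v)"
      by (rule prod_sum_PiE[symmetric]) (use I V in \<open>auto simp: B_def\<close>)
    also have "\<dots> = (\<Prod>i\<in>I - T. \<Sum>v\<in>V. w (h ` T) v)"
      using I by (intro prod.mono_neutral_cong_right) (auto simp: B_def)
    also have "\<dots> = (\<Sum>v\<in>V. w (h ` T) v) ^ card (I - T)" by simp
    also have "\<dots> \<le> (card V - d * (1 - exp (- s))) ^ card (I - T)"
    proof (rule power_mono)
      let ?H = "{v \<in> V. h ` T \<union> {v} \<in> E}"
      have "(\<Sum>v\<in>V. w (h ` T) v) = (\<Sum>v\<in>V. 1 - (if h ` T \<union> {v} \<in> E then 1 - exp (- s) else 0))"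
        by (rule sum.cong) (auto simp: w_def)
      also have "\<dots> = card V - card ?H * (1 - exp (- s))"
        using V by (simp add: sum_subtractf sum.If_cases Int_def)
      also have "\<dots> \<le> card V - d * (1 - exp (- s))"
      proof -
        have "h ` T \<subseteq> V" using h(1) by (auto simp: PiE_iff)
        then have "d \<le> card ?H" using deg[of "h ` T"] h(2) by (simp add: card_image)
        then show ?thesis using s by (simp add: mult_right_mono)
      qed
      finally show "(\<Sum>v\<in>V. w (h ` T) v) \<le> card V - d * (1 - exp (- s))" .
      show "0 \<le> (\<Sum>v\<in>V. w (h ` T) v)" by (rule sum_nonneg) (simp add: w_def)
    qed
    finally show ?thesis .
  qed
  let ?R = "{h \<in> T \<rightarrow>\<^sub>E V. inj_on h T}"
  have finTV: "finite (T \<rightarrow>\<^sub>E V)" using finT V by (intro finite_PiE) auto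
  then have finR: "finite ?R" by simp
  have "(\<Sum>f\<in>{f \<in> I \<rightarrow>\<^sub>E V. inj_on f T}. exp (- s * card {i \<in> I - T. f ` T \<union> {f i} \<in> E}))
      = (\<Sum>h\<in>?R. \<Sum>f\<in>{f \<in> {f \<in> I \<rightarrow>\<^sub>E V. inj_on f T}. restrict f T = h}. \<Prod>i\<in>I - T. w (f ` T) (f i))"
    unfolding weight
    by (rule sum.group[symmetric])
       (use finP finR I in \<open>auto simp: restrict_PiE_iff inj_on_def\<close>)
  also have "\<dots> = (\<Sum>h\<in>?R. \<Sum>f\<in>PiE I (B h). \<Prod>i\<in>I - T. w (f ` T) (f i))"
  proof (rule sum.cong[OF refl])
    fix h assume "h \<in> ?R"
    then have "h \<in> T \<rightarrow>\<^sub>E V" "inj_on h T" by auto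
    then show "(\<Sum>f\<in>{f \<in> {f \<in> I \<rightarrow>\<^sub>E V. inj_on f T}. restrict f T = h}. \<Prod>i\<in>I - T. w (f ` T) (f i))
        = (\<Sum>f\<in>PiE I (B h). \<Prod>i\<in>I - T. w (f ` T) (f i))"
      by (simp only: fibre)
  qed
  also have "\<dots> \<le> (\<Sum>h\<in>?R. (card V - d * (1 - exp (- s))) ^ card (I - T))"
    by (rule sum_mono) (use inner in auto)
  also have "\<dots> = card ?R * (card V - d * (1 - exp (- s))) ^ card (I - T)" by simp
  also have "\<dots> \<le> real (card V) ^ card T * (card V - d * (1 - exp (- s))) ^ card (I - T)"
  proof (rule mult_right_mono)
    have "card ?R \<le> card (T \<rightarrow>\<^sub>E V)"
      by (rule card_mono) (use finTV in auto)
    moreover have "card (T \<rightarrow>\<^sub>E V) = card V ^ card T" using finT by (simp add: card_PiE)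
    ultimately show "real (card ?R) \<le> real (card V) ^ card T"
      by (metis of_nat_le_iff of_nat_power)
    obtain S where S: "S \<subseteq> V" "card S = card T" using V T by (meson obtain_subset_with_card_n)
    then have "d \<le> card {v \<in> V. S \<union> {v} \<in> E}" by (rule deg)
    also have "\<dots> \<le> card V" using V by (simp add: card_mono)
    finally have "real d * (1 - exp (- s)) \<le> card V"
      using mult_mono[of "real d" "card V" "1 - exp (-s)" 1] s by simp
    then show "0 \<le> (card V - d * (1 - exp (- s))) ^ card (I - T)" by simp
  qed
  finally show ?thesis .
qed

text \<open>This makes the union bound over all \<open>j\<close>-subsets of an \<open>n\<close>-set effective.\<close>

lemma power_times_exp_small:
  fixes e :: real assumes "e > 0"
  shows "\<exists>N. \<forall>n\<ge>N. real n ^ j * exp (j - e^2 / 2 * n) < 1/2"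
proof -
  have "((\<lambda>n. real n ^ j * exp (j - e^2 / 2 * n)) \<longlongrightarrow> 0) at_top"
    using assms by real_asymp
  then have "\<forall>\<^sub>F n in at_top. real n ^ j * exp (j - e^2 / 2 * n) < 1/2"
    by (rule order_tendstoD) simp
  then show ?thesis by (simp add: eventually_at_top_linorder)
qed

text \<open>Multiply the Taylor bound for \<open>exp x\<close> by the right-hand side; the product of the two quadratics
  is \<open>1 + x^4 / 4\<close>.\<close>

lemma exp_minus_le_quadratic:
  fixes x :: real assumes "0 \<le> x" shows "exp (- x) \<le> 1 - x + x\<^sup>2 / 2"
proof -
  have "1 \<le> (1 - x + x\<^sup>2 / 2) * (1 + x + x\<^sup>2 / 2)"
    using zero_le_power2[of "x\<^sup>2"] by (simp add: algebra_simps power2_eq_square)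
  also have "\<dots> \<le> (1 - x + x\<^sup>2 / 2) * exp x"
  proof (rule mult_left_mono)
    show "1 + x + x\<^sup>2 / 2 \<le> exp x" using assms by (rule exp_lower_Taylor_quadratic)
    have "0 \<le> (1 - x)\<^sup>2 + 1" by simp
    then show "0 \<le> 1 - x + x\<^sup>2 / 2" by (simp add: power2_eq_square algebra_simps)
  qed
  finally show ?thesis by (simp add: exp_minus field_simps)
qed

text \<open>A collision \<open>f a = f b\<close> determines \<open>f\<close> from its values outside \<open>b\<close>.  For \<open>card V\<close> much larger than
  \<open>n\<close>, sampling with replacement is therefore almost always injective.\<close>

lemma card_noninjective_le:
  assumes "finite V"
  shows "card {f \<in> {..<n} \<rightarrow>\<^sub>E V. \<not> inj_on f {..<n}} \<le> n\<^sup>2 * card V ^ (n - 1)"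
proof -
  let ?C = "\<lambda>(a, b). {f \<in> {..<n} \<rightarrow>\<^sub>E V. a \<noteq> b \<and> f a = f b}"
  have fin: "finite (A \<rightarrow>\<^sub>E V)" if "finite A" for A :: "nat set"
    using assms that by (intro finite_PiE) auto
  have le: "card (?C ab) \<le> card V ^ (n - 1)" if ab: "ab \<in> {..<n} \<times> {..<n}" for ab
  proof -
    obtain a b where ab': "ab = (a, b)" "a < n" "b < n" using ab by auto
    have "card (?C ab) \<le> card ({..<n} - {b} \<rightarrow>\<^sub>E V)"
    proof (rule card_inj_on_le)
      show "inj_on (\<lambda>f. restrict f ({..<n} - {b})) (?C ab)"
      proof (rule inj_onI)
        fix f h assume f: "f \<in> ?C ab" and h: "h \<in> ?C ab"
          and eq: "restrict f ({..<n} - {b}) = restrict h ({..<n} - {b})"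
        have "f i = h i" if "i \<in> {..<n} - {b}" for i using fun_cong[OF eq, of i] that by simp
        moreover have "f b = h b" using calculation[of a] f h ab' by auto
        ultimately have "f i = h i" if "i < n" for i using that by (cases "i = b") auto
        then show "f = h" using f h ab' by (intro PiE_ext[of f "{..<n}" "\<lambda>_. V" h]) auto
      qed
      show "(\<lambda>f. restrict f ({..<n} - {b})) ` ?C ab \<subseteq> {..<n} - {b} \<rightarrow>\<^sub>E V"
      proof (rule image_subsetI)
        fix f assume "f \<in> ?C ab"
        then have "\<forall>i\<in>{..<n}. f i \<in> V" unfolding ab' by (simp add: PiE_iff)
        then show "restrict f ({..<n} - {b}) \<in> {..<n} - {b} \<rightarrow>\<^sub>E V"
          by (simp add: restrict_PiE_iff)
      qed
      show "finite ({..<n} - {b} \<rightarrow>\<^sub>E V)" by (rule fin) simp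
    qed
    also have "\<dots> = card V ^ (n - 1)" using ab' by (simp add: card_PiE)
    finally show ?thesis .
  qed
  have "{f \<in> {..<n} \<rightarrow>\<^sub>E V. \<not> inj_on f {..<n}} \<subseteq> (\<Union>ab\<in>{..<n} \<times> {..<n}. ?C ab)"
    by (fastforce simp: inj_on_def)
  then have "card {f \<in> {..<n} \<rightarrow>\<^sub>E V. \<not> inj_on f {..<n}} \<le> card (\<Union>ab\<in>{..<n} \<times> {..<n}. ?C ab)"
    by (rule card_mono[rotated]) (use fin[of "{..<n}"] in auto)
  also have "\<dots> \<le> (\<Sum>ab\<in>{..<n} \<times> {..<n}. card (?C ab))" by (rule card_UN_le) simp
  also have "\<dots> \<le> (\<Sum>ab\<in>{..<n} \<times> {..<n}. card V ^ (n - 1))" by (rule sum_mono) (rule le)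
  also have "\<dots> = n\<^sup>2 * card V ^ (n - 1)" by (simp add: power2_eq_square)
  finally show ?thesis .
qed

text \<open>Chernoff bound: Markov's inequality for \<open>exp (- s h)\<close>, where \<open>h\<close> counts the sampled vertices
  that extend the image of \<open>T\<close> to an edge.  The choice \<open>s = e\<close> turns the exponent into
  \<open>- e^2 n / 2\<close> up to the constant \<open>card T\<close>.\<close>

lemma card_low_degree_samples_le:
  fixes V :: "'a set" and E :: "'a set set" and e :: real
  assumes V: "finite V" "V \<noteq> {}" and T: "T \<subseteq> {..<n}" "card T \<le> card V"
    and d: "d \<le> card V"
    and deg: "\<And>S. S \<subseteq> V \<Longrightarrow> card S = card T \<Longrightarrow> d \<le> card {v \<in> V. S \<union> {v} \<in> E}"
    and e: "0 < e" "e \<le> 1"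
  shows "real (card {f \<in> {..<n} \<rightarrow>\<^sub>E V. inj_on f T \<and>
            card {i \<in> {..<n} - T. f ` T \<union> {f i} \<in> E} < (d / card V - e) * n})
          \<le> real (card V) ^ n * exp (card T - e\<^sup>2 / 2 * n)" (is "real (card ?Bad) \<le> _")
proof -
  define m c j q where "m = real (card V)" and "c = d / card V" and "j = card T" and "q = exp (- e)"
  have m: "m > 0" using V by (simp add: m_def card_gt_0_iff)
  have c: "0 \<le> c" "c \<le> 1" "real d = m * c" using d m by (auto simp: c_def m_def divide_simps)
  have jn: "j \<le> n" unfolding j_def using card_mono[OF _ T(1)] by simp
  have q: "1 - e \<le> q" "q \<le> 1 - e + e\<^sup>2 / 2" "0 < q" "q \<le> 1"
    using exp_ge_add_one_self[of "- e"] exp_minus_le_quadratic[of e] e by (auto simp: q_def)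
  have finP: "finite ({..<n} \<rightarrow>\<^sub>E V)" using V by (intro finite_PiE) auto
  let ?h = "\<lambda>f. card {i \<in> {..<n} - T. f ` T \<union> {f i} \<in> E}"
  have "card ?Bad * exp (- e * ((c - e) * n)) = (\<Sum>f\<in>?Bad. exp (- e * ((c - e) * n)))" by simp
  also have "\<dots> \<le> (\<Sum>f\<in>?Bad. exp (- e * ?h f))"
    by (rule sum_mono) (use e in \<open>auto simp: c_def\<close>)
  also have "\<dots> \<le> (\<Sum>f\<in>{f \<in> {..<n} \<rightarrow>\<^sub>E V. inj_on f T}. exp (- e * ?h f))"
    by (rule sum_mono2) (use finP in auto)
  also have "\<dots> \<le> m ^ j * (card V - d * (1 - q)) ^ card ({..<n} - T)"
    unfolding m_def j_def q_def
    by (rule sum_exp_hits_le) (use T V deg e in auto)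
  also have "card ({..<n} - T) = n - j"
    unfolding j_def using T(1) by (simp add: card_Diff_subset finite_subset)
  also have "card V - d * (1 - q) = m * (1 - c * (1 - q))"
    using c(3) by (simp add: m_def algebra_simps)
  also have "m ^ j * (m * (1 - c * (1 - q))) ^ (n - j) = m ^ n * (1 - c * (1 - q)) ^ (n - j)"
    using jn by (simp add: power_mult_distrib power_add[symmetric])
  also have "\<dots> \<le> m ^ n * exp (- (c * (1 - q))) ^ (n - j)"
  proof (intro mult_left_mono power_mono)
    show "1 - c * (1 - q) \<le> exp (- (c * (1 - q)))" using exp_ge_add_one_self[of "- (c * (1 - q))"] by simp
    show "0 \<le> 1 - c * (1 - q)" using mult_mono[of c 1 "1 - q" 1] c q by simp
  qed (use m in auto)
  also have "exp (- (c * (1 - q))) ^ (n - j) = exp (- (c * (1 - q) * (real n - j)))"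
    using jn by (simp add: exp_of_nat_mult[symmetric] mult.commute)
  finally have "card ?Bad \<le> m ^ n * exp (- (c * (1 - q) * (real n - j))) / exp (- e * ((c - e) * n))"
    by (simp add: field_simps)
  also have "\<dots> = m ^ n * exp (- (c * (1 - q) * (real n - j)) - (- e * ((c - e) * n)))"
    by (simp only: exp_diff times_divide_eq_right)
  also have "\<dots> \<le> m ^ n * exp (j - e\<^sup>2 / 2 * n)"
  proof -
    have "c * (1 - q) * j \<le> 1 * real j" using c q mult_mono[of c 1 "1 - q" 1] by (intro mult_right_mono) auto
    moreover have "c * n * (e - (1 - q)) \<le> 1 * real n * (e\<^sup>2 / 2)"
      using c q by (intro mult_mono) auto
    ultimately have "- (c * (1 - q) * (real n - j)) - (- e * ((c - e) * n)) \<le> j - e\<^sup>2 / 2 * n"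
      by (simp add: algebra_simps power2_eq_square)
    then show ?thesis using m by simp
  qed
  finally show ?thesis by (simp add: m_def j_def)
qed

text \<open>Union bound: fewer than half of the samples have a collision because \<open>card V > 2 n^2\<close>, and
  fewer than half have a low codegree at some \<open>j\<close>-set.\<close>

lemma exists_good_sample:
  fixes V :: "'a set" and E :: "'a set set" and e :: real
  assumes V: "finite V" and j: "j \<le> n" and m: "2 * n\<^sup>2 < card V"
    and deg: "\<And>S. S \<subseteq> V \<Longrightarrow> card S = j \<Longrightarrow> d \<le> card {v \<in> V. S \<union> {v} \<in> E}"
    and e: "0 < e" "e \<le> 1" and small: "real n ^ j * exp (j - e\<^sup>2 / 2 * n) < 1 / 2"
  obtains f where "f ` {..<n} \<subseteq> V" "inj_on f {..<n}"
    "\<And>T. T \<subseteq> {..<n} \<Longrightarrow> card T = j \<Longrightarrow>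
       (d / card V - e) * n \<le> card {i \<in> {..<n}. f ` T \<union> {f i} \<in> E}"
proof -
  define m where "m = card V"
  let ?P = "{..<n} \<rightarrow>\<^sub>E V"
  let ?NI = "{f \<in> ?P. \<not> inj_on f {..<n}}"
  let ?Bad = "\<lambda>T. {f \<in> ?P. inj_on f T \<and> card {i \<in> {..<n} - T. f ` T \<union> {f i} \<in> E} < (d / card V - e) * n}"
  let ?TT = "{T. T \<subseteq> {..<n} \<and> card T = j}"
  have mpos: "0 < m" using m by (simp add: m_def)
  have nm: "n \<le> m" using m self_le_power[of n 2] unfolding m_def by (cases "n = 0") auto
  obtain S where S: "S \<subseteq> V" "card S = j"
    using V j nm unfolding m_def by (meson obtain_subset_with_card_n order.trans)
  have d: "d \<le> card V" using deg[OF S] card_mono[of V "{v \<in> V. S \<union> {v} \<in> E}"] V by auto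
  have finP: "finite ?P" using V by (intro finite_PiE) auto
  have "\<exists>f\<in>?P. f \<notin> ?NI \<union> (\<Union>T\<in>?TT. ?Bad T)"
  proof (rule ccontr)
    assume "\<not> ?thesis"
    then have "?P \<subseteq> ?NI \<union> (\<Union>T\<in>?TT. ?Bad T)" by blast
    then have "card ?P \<le> card (?NI \<union> (\<Union>T\<in>?TT. ?Bad T))"
      by (rule card_mono[rotated]) (use finP in auto)
    also have "\<dots> \<le> card ?NI + (\<Sum>T\<in>?TT. card (?Bad T))"
      using card_Un_le[of ?NI "\<Union>T\<in>?TT. ?Bad T"] card_UN_le[of ?TT ?Bad] by simp
    finally have "real (card ?P) \<le> real (card ?NI + (\<Sum>T\<in>?TT. card (?Bad T)))"
      by (simp only: of_nat_le_iff)
    then have "real (card ?P) \<le> card ?NI + (\<Sum>T\<in>?TT. real (card (?Bad T)))"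
      by (simp only: of_nat_add of_nat_sum)
    also have "(\<Sum>T\<in>?TT. real (card (?Bad T))) \<le> (\<Sum>T\<in>?TT. real m ^ n * exp (j - e\<^sup>2 / 2 * n))"
    proof (rule sum_mono)
      fix T assume T: "T \<in> ?TT"
      then show "real (card (?Bad T)) \<le> real m ^ n * exp (j - e\<^sup>2 / 2 * n)"
        using card_low_degree_samples_le[of V T n d E e] V d deg e mpos nm j
        unfolding m_def by fastforce
    qed
    also have "\<dots> = (n choose j) * (real m ^ n * exp (j - e\<^sup>2 / 2 * n))"
      using n_subsets[of "{..<n}" j] by simp
    also have "\<dots> \<le> real n ^ j * (real m ^ n * exp (j - e\<^sup>2 / 2 * n))"
      using binomial_le_pow[OF j] by (intro mult_right_mono) (simp_all flip: of_nat_power)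
    also have "\<dots> = real m ^ n * (real n ^ j * exp (j - e\<^sup>2 / 2 * n))" by simp
    also have "\<dots> < real m ^ n * (1 / 2)"
      using small mpos by (intro mult_strict_left_mono) auto
    finally have A: "real (card ?P) < card ?NI + real m ^ n / 2" by simp
    have P: "card ?P = m ^ n" by (simp add: card_PiE m_def)
    show False
    proof (cases "n = 0")
      case True
      then show False using A P by simp
    next
      case False
      have "card ?NI \<le> n\<^sup>2 * m ^ (n - 1)" unfolding m_def by (rule card_noninjective_le) (rule V)
      then have "2 * card ?NI \<le> 2 * n\<^sup>2 * m ^ (n - 1)" by simp
      also have "\<dots> \<le> m * m ^ (n - 1)" using m unfolding m_def by (intro mult_right_mono) auto
      also have "\<dots> = m ^ n" using False by (simp add: power_eq_if)
      finally have "real (2 * card ?NI) \<le> real (m ^ n)" by (simp only: of_nat_le_iff)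
      then have "2 * real (card ?NI) \<le> real m ^ n" by simp
      then show False using A P by simp
    qed
  qed
  then obtain f where f: "f \<in> ?P" "inj_on f {..<n}" "\<And>T. T \<in> ?TT \<Longrightarrow> f \<notin> ?Bad T" by blast
  show thesis
  proof (rule that)
    show "f ` {..<n} \<subseteq> V" using f(1) by auto
    show "inj_on f {..<n}" by (rule f(2))
    fix T assume T: "T \<subseteq> {..<n}" "card T = j"
    then have "inj_on f T" using f(2) inj_on_subset by blast
    then have "(d / card V - e) * n \<le> card {i \<in> {..<n} - T. f ` T \<union> {f i} \<in> E}"
      using f(1) f(3)[of T] T by auto
    also have "\<dots> \<le> card {i \<in> {..<n}. f ` T \<union> {f i} \<in> E}"
      unfolding of_nat_le_iff by (rule card_mono) auto
    finally show "(d / card V - e) * n \<le> card {i \<in> {..<n}. f ` T \<union> {f i} \<in> E}" .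
  qed
qed

section \<open>Existence of the codegree density\<close>

lemma min_codegree_le:
  assumes "uniform_hypergraph k G" "S \<subseteq> verts G" "card S = k - 1"
  shows "min_codegree k G \<le> codegree G S"
  using assms unfolding min_codegree_def uniform_hypergraph_def
  by (intro Min_le) auto

lemma min_codegree_attained:
  assumes "uniform_hypergraph k G" "k - 1 \<le> card (verts G)"
  obtains S where "S \<subseteq> verts G" "card S = k - 1" "min_codegree k G = codegree G S"
proof -
  let ?S = "{S. S \<subseteq> verts G \<and> card S = k - 1}"
  have "?S \<noteq> {}" using assms(2) by (metis (mono_tags) empty_Collect_eq obtain_subset_with_card_n)
  moreover have "finite ?S" using assms(1) unfolding uniform_hypergraph_def by auto
  ultimately have "Min (codegree G ` ?S) \<in> codegree G ` ?S" by (intro Min_in) auto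
  then show thesis using that unfolding min_codegree_def by blast
qed

lemma codegree_le_card:
  assumes "uniform_hypergraph k G" shows "codegree G S \<le> card (verts G)"
  using assms unfolding codegree_def uniform_hypergraph_def by (intro card_mono) auto

lemma min_codegree_le_card:
  assumes "uniform_hypergraph k G" "k - 1 \<le> card (verts G)"
  shows "min_codegree k G \<le> card (verts G)"
  using assms by (metis min_codegree_attained codegree_le_card)

context
  fixes k :: nat and F :: "'b hypergraph"
begin

abbreviation free_codegrees :: "nat \<Rightarrow> nat set" where
  "free_codegrees n \<equiv> {min_codegree k G | G :: nat hypergraph.
      uniform_hypergraph k G \<and> card (verts G) = n \<and> \<not> contains_copy G F}"

lemma finite_free_codegrees: "k - 1 \<le> n \<Longrightarrow> finite (free_codegrees n)"
  by (rule finite_subset[of _ "{..n}"]) (use min_codegree_le_card in auto)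

lemma codegree_ex_ge:
  fixes G :: "nat hypergraph"
  assumes "uniform_hypergraph k G" "card (verts G) = n" "\<not> contains_copy G F" "k - 1 \<le> n"
    and "\<And>S. S \<subseteq> verts G \<Longrightarrow> card S = k - 1 \<Longrightarrow> d \<le> real (codegree G S)"
  shows "d \<le> codegree_ex k n F"
proof -
  have "min_codegree k G \<le> codegree_ex k n F"
    unfolding codegree_ex_def
    using assms(1-3) by (intro Max_ge finite_free_codegrees[OF assms(4)]) blast
  moreover have "d \<le> min_codegree k G"
    using assms by (metis min_codegree_attained)
  ultimately show ?thesis by linarith
qed

lemma codegree_ex_attained:
  assumes "edges F \<noteq> {}" "k - 1 \<le> n"
  obtains G :: "nat hypergraph" where "uniform_hypergraph k G" "card (verts G) = n"
    "\<not> contains_copy G F" "min_codegree k G = codegree_ex k n F"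
proof -
  let ?G = "({..<n}, {}) :: nat hypergraph"
  have "uniform_hypergraph k ?G" "card (verts ?G) = n" "\<not> contains_copy ?G F"
    using assms(1) by (auto simp: uniform_hypergraph_def contains_copy_def)
  then have "free_codegrees n \<noteq> {}" by blast
  then have "codegree_ex k n F \<in> free_codegrees n"
    unfolding codegree_ex_def using assms(2) by (intro Max_in finite_free_codegrees)
  then show thesis using that by auto
qed

text \<open>The sub-hypergraph induced by a good sample of an extremal host is still free of \<open>F\<close>.\<close>

lemma codegree_ex_sample:
  assumes F: "edges F \<noteq> {}" and k: "1 \<le> k" and e: "0 < e" "e \<le> 1"
    and n: "k - 1 \<le> n" "0 < n" "real n ^ (k - 1) * exp (real (k - 1) - e\<^sup>2 / 2 * n) < 1 / 2"
    and m: "2 * n\<^sup>2 < m"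
  shows "codegree_ex k m F / real m \<le> codegree_ex k n F / real n + e"
proof -
  have "n \<le> m" using m self_le_power[of n 2] n(2) by auto
  then have km: "k - 1 \<le> m" using n by simp
  obtain G :: "nat hypergraph" where G: "uniform_hypergraph k G" "card (verts G) = m"
    "\<not> contains_copy G F" "min_codegree k G = codegree_ex k m F"
    using codegree_ex_attained[OF F km] .
  have fin: "finite (verts G)" using G(1) by (simp add: uniform_hypergraph_def)
  obtain f where f: "f ` {..<n} \<subseteq> verts G" "inj_on f {..<n}"
    and deg: "\<And>T. T \<subseteq> {..<n} \<Longrightarrow> card T = k - 1 \<Longrightarrow>
       (codegree_ex k m F / card (verts G) - e) * n \<le> card {i \<in> {..<n}. f ` T \<union> {f i} \<in> edges G}"
  proof (rule exists_good_sample[of "verts G" "k - 1" n "codegree_ex k m F" "edges G" e])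
    show "finite (verts G)" by (rule fin)
    show "2 * n\<^sup>2 < card (verts G)" using m G(2) by simp
    show "codegree_ex k m F \<le> card {v \<in> verts G. S \<union> {v} \<in> edges G}"
      if "S \<subseteq> verts G" "card S = k - 1" for S
      using min_codegree_le[OF G(1) that] G(4) by (simp add: codegree_def)
  qed (use n e in auto)
  define H :: "nat hypergraph" where "H = (f ` {..<n}, {E \<in> edges G. E \<subseteq> f ` {..<n}})"
  have "(codegree_ex k m F / m - e) * n \<le> codegree_ex k n F"
  proof (rule codegree_ex_ge)
    show "uniform_hypergraph k H" using G(1) by (auto simp: H_def uniform_hypergraph_def)
    show "card (verts H) = n" using f(2) by (simp add: H_def card_image)
    show "\<not> contains_copy H F"
    proof
      assume "contains_copy H F"
      then have "contains_copy G F" unfolding contains_copy_def H_def using f(1)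
        by fastforce
      then show False using G(3) by simp
    qed
    show "k - 1 \<le> n" by (rule n)
    fix S assume S: "S \<subseteq> verts H" "card S = k - 1"
    then obtain T where T: "T \<subseteq> {..<n}" "S = f ` T" unfolding H_def by (auto simp: subset_image_iff)
    then have cT: "card T = k - 1" using S(2) f(2) by (metis card_image inj_on_subset)
    have "codegree H S = card (f ` {i \<in> {..<n}. f ` T \<union> {f i} \<in> edges G})"
      unfolding codegree_def using T by (intro arg_cong[of _ _ card]) (auto simp: H_def)
    also have "\<dots> = card {i \<in> {..<n}. f ` T \<union> {f i} \<in> edges G}"
      by (rule card_image) (use f(2) in \<open>auto intro: inj_on_subset\<close>)
    finally show "(codegree_ex k m F / m - e) * n \<le> codegree H S"
      using deg[OF T(1) cT] G(2) by simp
  qed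
  then show ?thesis using n(2) by (simp add: field_simps)
qed

theorem convergent_codegree_ex:
  assumes F: "edges F \<noteq> {}" and k: "1 \<le> k"
  shows "convergent (\<lambda>n. codegree_ex k n F / real n)"
proof (rule convergent_of_eventually_almost_decreasing)
  fix e :: real assume "e > 0"
  define e' where "e' = min e 1"
  have e': "0 < e'" "e' \<le> 1" "e' \<le> e" using \<open>e > 0\<close> by (auto simp: e'_def)
  obtain N where N: "\<And>n. n \<ge> N \<Longrightarrow> real n ^ (k - 1) * exp (real (k - 1) - e'\<^sup>2 / 2 * n) < 1 / 2"
    using power_times_exp_small[OF e'(1)] by meson
  have "codegree_ex k m F / real m \<le> codegree_ex k n F / real n + e"
    if "n \<ge> max N k" "m \<ge> 2 * n\<^sup>2 + 1" for n m
  proof -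
    have "k - 1 \<le> n" "0 < n" "n \<ge> N" "2 * n\<^sup>2 < m" using that k by linarith+
    then show ?thesis using codegree_ex_sample[OF F k e'(1,2), of n m] N[of n] e'(3) by simp
  qed
  then show "\<exists>N. \<forall>n\<ge>N. \<exists>M. \<forall>m\<ge>M. codegree_ex k m F / real m \<le> codegree_ex k n F / real n + e"
    by blast
qed simp

lemma codegree_turan_density_ge:
  fixes c b :: real
  assumes F: "edges F \<noteq> {}" and k: "1 \<le> k"
    and ex: "\<And>n. n \<ge> k \<Longrightarrow> c * n - b \<le> codegree_ex k n F"
  shows "c \<le> codegree_turan_density k F"
proof (rule LIMSEQ_le)
  show "(\<lambda>n. codegree_ex k n F / real n) \<longlonglongrightarrow> codegree_turan_density k F"
    using convergent_codegree_ex[OF F k] unfolding codegree_turan_density_def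
    by (simp add: convergent_LIMSEQ_iff)
  show "(\<lambda>n. c - b / real n) \<longlonglongrightarrow> c" by real_asymp
  have "c - b / real n \<le> codegree_ex k n F / real n" if "n \<ge> k" for n
  proof -
    have "(c * n - b) / n \<le> codegree_ex k n F / real n" using ex[OF that] by (rule divide_right_mono) simp
    then show ?thesis using k that by (simp add: diff_divide_distrib)
  qed
  then show "\<exists>N. \<forall>n\<ge>N. c - b / real n \<le> codegree_ex k n F / real n" by blast
qed

end

section \<open>Windows of periodic sequences\<close>

lemma sum_mset_repeat_mset: "sum_mset (repeat_mset r M) = r * sum_mset M" for M :: "nat multiset"
  by (induction r) auto

lemma image_mset_repeat_mset: "image_mset h (repeat_mset r M) = repeat_mset r (image_mset h M)"
  by (induction r) auto

lemma set_mset_repeat_mset: "0 < r \<Longrightarrow> set_mset (repeat_mset r M) = set_mset M"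
  by (rule set_eqI) (simp flip: count_greater_zero_iff)

lemma pair_mset_eq_iff: "{#a, b#} = {#c, d#} \<longleftrightarrow> a = c \<and> b = d \<or> a = d \<and> b = c"
proof
  assume eq: "{#a, b#} = {#c, d#}"
  have "a \<in># {#c, d#}" unfolding eq[symmetric] by simp
  then consider "a = c" | "a = d" by auto
  then show "a = c \<and> b = d \<or> a = d \<and> b = c"
    by cases (use eq in \<open>simp_all add: add_mset_commute[of _ d]\<close>)
qed (auto simp: add_mset_commute)

text \<open>Positions are not reduced modulo the cycle length; a periodic \<open>Q\<close> takes care of the wrap-around.\<close>

definition window :: "(nat \<Rightarrow> 'a) \<Rightarrow> nat \<Rightarrow> nat \<Rightarrow> 'a multiset" where
  "window Q i k = image_mset Q (mset_set {i..<i + k})"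

lemma image_window: "image_mset h (window Q i k) = window (\<lambda>n. h (Q n)) i k"
  by (simp add: window_def multiset.map_comp comp_def)

lemma window_add: "window Q i (a + b) = window Q i a + window Q (i + a) b"
proof -
  have "{i..<i + (a + b)} = {i..<i + a} \<union> {i + a..<i + a + b}" by auto
  moreover have "mset_set ({i..<i + a} \<union> {i + a..<i + a + b}) = mset_set {i..<i + a} + mset_set {i + a..<i + a + b}"
    by (rule mset_set_Union) auto
  ultimately show ?thesis by (simp add: window_def)
qed

lemma window_one: "window Q i (Suc 0) = {#Q i#}"
  by (simp add: window_def)

lemma window_slide: "add_mset (Q (i + k)) (window Q i k) = add_mset (Q i) (window Q (Suc i) k)"
  using window_add[of Q i k 1] window_add[of Q i 1 k] by (simp add: window_one)

lemma window_periodic: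
  assumes "\<And>n. Q (n + g) = Q n"
  shows "window Q i (r * g) = repeat_mset r (window Q i g)"
proof (induction r)
  case 0 then show ?case by (simp add: window_def)
next
  case (Suc r)
  have "window Q i (r * g + g) = window Q i (r * g) + window Q (i + r * g) g" by (rule window_add)
  moreover have "window Q (i + r * g) g = window Q i g"
  proof -
    have Q: "Q (n + r * g) = Q n" for n
      by (induction r) (use assms in \<open>auto simp: add.assoc[symmetric] add.commute[of g]\<close>)
    have "mset_set {i + r * g..<i + r * g + g} = image_mset (\<lambda>n. n + r * g) (mset_set {i..<i + g})"
      by (subst image_mset_mset_set) (auto simp: add.commute add.left_commute)
    then show ?thesis using Q by (simp add: window_def multiset.map_comp comp_def)
  qed
  ultimately show ?case using Suc by (simp add: add.commute)
qed

lemma period_gcd: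
  fixes Q :: "nat \<Rightarrow> 'a"
  assumes "\<And>n. Q (n + a) = Q n" "\<And>n. Q (n + b) = Q n" "a \<noteq> 0"
  shows "Q (n + gcd a b) = Q n"
proof -
  have mult: "Q (n + x * a) = Q n" "Q (n + x * b) = Q n" for n x
    by (induction x) (use assms in \<open>auto simp: add.assoc[symmetric] add.commute[of a] add.commute[of b]\<close>)
  obtain x y where "a * x = b * y + gcd a b" using bezout_nat[OF assms(3)] by blast
  then have "n + gcd a b + y * b = n + x * a" by (simp add: algebra_simps)
  then show ?thesis by (metis mult)
qed

text \<open>The steps \<open>n \<mapsto> n + k\<close> modulo \<open>l\<close> form \<open>gcd k l\<close> closed cycles, one for each residue modulo
  \<open>gcd k l\<close>.  Only the steps from \<open>0\<close> and from \<open>l - 1\<close> may fail to be links, and they lie on different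
  cycles.  Going round the rest of its cycle supplies each of these two links.\<close>

lemma periodic_of_links:
  fixes Q :: "nat \<Rightarrow> 'a"
  assumes l: "0 < l" and k: "0 < k" and g: "1 < gcd k l"
    and per: "\<And>n. Q (n mod l) = Q n"
    and link: "\<And>i. 1 \<le> i \<Longrightarrow> i + 1 < l \<Longrightarrow> Q (i + k) = Q i"
  shows "Q (n + gcd k l) = Q n"
proof (rule period_gcd)
  define g where "g = gcd k l"
  define L where "L = l div g"
  have g1: "1 < g" "g dvd k" "g dvd l" using assms(3) by (auto simp: g_def)
  have L: "l = L * g" "0 < L" using g1 l by (auto simp: L_def elim!: dvdE)
  have cop: "coprime L (k div g)"
    unfolding L_def g_def using l by (metis coprime_commute div_gcd_coprime less_not_refl)
  have not_dvd: "\<not> l dvd s * k" if s: "0 < s" "s < L" for s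
  proof
    assume "l dvd s * k"
    then have "L * g dvd s * (k div g) * g" using L(1) g1(2) by (simp add: mult.assoc)
    then have "L dvd s * (k div g)" using g1(1) by simp
    then have "L dvd s" using cop by (simp add: coprime_dvd_mult_left_iff)
    then show False using s by (simp add: nat_dvd_not_less)
  qed
  have per_add: "Q (n + l * j) = Q n" for n j by (metis per mod_mult_self2)
  have boundary: "Q (b + k) = Q b" if b: "b = 0 \<or> b = l - 1" for b
  proof -
    \<comment> \<open>Walk from \<open>b + k\<close> along the cycle of \<open>b\<close>; the walk first meets \<open>b\<close> again for \<open>s = L\<close> and never meets the other exceptional position.\<close>
    have "Q (b + s * k) = Q (b + k)" if "1 \<le> s" "s \<le> L" for s
      using that
    proof (induction s rule: dec_induct)
      case base then show ?case by simp
    next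
      case (step s)
      define i where "i = (b + s * k) mod l"
      have il: "i < l" using l by (simp add: i_def)
      have "i mod g = (b + s * k) mod g" using g1 by (simp add: i_def mod_mod_cancel)
      then have ig: "i mod g = b mod g" using g1(2) by (auto simp: mult.left_commute[of s] elim!: dvdE)
      have "i \<noteq> b"
      proof
        assume "i = b"
        moreover have "b mod l = b" using b l by auto
        ultimately have "(b + s * k) mod l = (b + 0) mod l" by (simp add: i_def)
        then have "s * k mod l = 0"
          by (metis Cong.cong_def cong_add_lcancel_nat mod_0)
        then show False using not_dvd[of s] step by auto
      qed
      moreover have "i \<noteq> 0" if "b = l - 1"
      proof
        assume "i = 0"
        then have "g dvd l - 1" using ig that by auto
        then have "g dvd l - (l - 1)" using g1(3) by (rule dvd_diff_nat[rotated])
        then show False using g1 l by simp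
      qed
      moreover have "i \<noteq> l - 1" if "b = 0"
      proof
        assume "i = l - 1"
        then have "g dvd l - 1" using ig that by auto
        then have "g dvd l - (l - 1)" using g1(3) by (rule dvd_diff_nat[rotated])
        then show False using g1 l by simp
      qed
      ultimately have "1 \<le> i" "i + 1 < l" using b il by auto
      then have "Q (i + k) = Q i" by (rule link)
      moreover have "Q (i + k) = Q (b + Suc s * k)"
        by (metis per i_def mod_add_left_eq add.assoc add.commute mult_Suc)
      moreover have "Q i = Q (b + s * k)" by (simp add: i_def per)
      ultimately show ?case using step by simp
    qed
    from this[of L] have "Q (b + L * k) = Q (b + k)" using L(2) by simp
    moreover have "L * k = l * (k div g)" using L(1) g1(2) by auto
    ultimately show ?thesis using per_add by simp
  qed
  show "Q (n + k) = Q n" for n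
  proof -
    have "Q (n mod l + k) = Q (n mod l)"
    proof (cases "n mod l = 0 \<or> n mod l = l - 1")
      case True then show ?thesis by (rule boundary)
    next
      case False
      then have "1 \<le> n mod l" "n mod l + 1 < l" using mod_less_divisor[OF l, of n] by linarith+
      then show ?thesis by (rule link)
    qed
    moreover have "Q (n mod l + k) = Q (n + k)" by (metis per mod_add_left_eq)
    ultimately show ?thesis by (simp add: per)
  qed
  show "Q (n + l) = Q n" for n using per_add[of n 1] by simp
  show "k \<noteq> 0" using k by simp
qed

section \<open>Hosts defined by vertex colourings\<close>

lemma card_residue_class_ge:
  assumes "c < q" shows "n div q \<le> card {v \<in> {..<n}. v mod q = c}"
proof -
  have "card ((\<lambda>i. i * q + c) ` {..<n div q}) \<le> card {v \<in> {..<n}. v mod q = c}"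
  proof (rule card_mono)
    have "i * q + c < n" if "i < n div q" for i
    proof -
      have "Suc i * q \<le> n div q * q" using that by (intro mult_right_mono) auto
      also have "\<dots> \<le> n" by simp
      finally show ?thesis using assms by simp
    qed
    then show "(\<lambda>i. i * q + c) ` {..<n div q} \<subseteq> {v \<in> {..<n}. v mod q = c}" using assms by auto
  qed simp
  moreover have "inj_on (\<lambda>i. i * q + c) {..<n div q}" using assms by (auto simp: inj_on_def)
  ultimately show ?thesis by (simp add: card_image)
qed

lemma tight_edge_eq: "tight_edge k l i = (\<lambda>n. n mod l) ` {i..<i + k}"
proof -
  have "{i..<i + k} = (\<lambda>j. i + j) ` {..<k}"
    using image_add_atLeastLessThan[of i 0 k] by (simp add: atLeast0LessThan add.commute)
  then show ?thesis by (simp add: tight_edge_def image_image)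
qed

lemma inj_on_mod_interval: "k \<le> l \<Longrightarrow> inj_on (\<lambda>n. n mod l) {i..<i + k :: nat}"
proof (rule linorder_inj_onI)
  fix x y assume "x < y" "x \<in> {i..<i + k}" "y \<in> {i..<i + k}" and kl: "k \<le> l"
  then have "0 < y - x" "y - x < l" by auto
  then have "\<not> l dvd y - x" by (simp add: nat_dvd_not_less)
  then show "x mod l \<noteq> y mod l" using \<open>x < y\<close> by (metis mod_eq_dvd_iff_nat less_imp_le)
qed auto

text \<open>Edges are compared as sets, so removing the first edge could remove others as well; \<open>k < l\<close>
  excludes this.\<close>

lemma tight_edge_neq_first:
  assumes "0 < i" "i < l" "0 < k" "k < l"
  shows "tight_edge k l i \<noteq> tight_edge k l 0"
proof -
  have first: "tight_edge k l 0 = {..<k}"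
    using assms unfolding tight_edge_def by (auto simp: image_def)
  have "\<exists>x\<in>tight_edge k l i. k \<le> x"
  proof (cases "i < k")
    case True
    have "k mod l \<in> tight_edge k l i" unfolding tight_edge_eq using True assms by (intro imageI) auto
    then show ?thesis using assms by auto
  next
    case False
    have "i mod l \<in> tight_edge k l i" unfolding tight_edge_eq using assms by (intro imageI) auto
    then show ?thesis using False assms by (intro bexI[of _ i]) auto
  qed
  then show ?thesis unfolding first by force
qed

text \<open>The vertex \<open>v\<close> gets the colour \<open>v mod q\<close>, and \<open>P\<close> selects the colour multisets of edges.  The
  windows with start \<open>1, \<dots>, l - 1\<close> are the edges of the cycle other than the removed one.\<close>

theorem density_ge_of_colour_pattern:
  fixes P :: "nat multiset \<Rightarrow> bool"
  assumes k: "0 < k" "k < l" and q: "0 < q"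
    and extend: "\<And>X. size X = k - 1 \<Longrightarrow> set_mset X \<subseteq> {..<q} \<Longrightarrow> \<exists>c<q. P (add_mset c X)"
    and no_cycle: "\<And>Q. (\<And>n. Q n < q) \<Longrightarrow> (\<And>n. Q (n mod l) = Q n) \<Longrightarrow>
      (\<And>i. 1 \<le> i \<Longrightarrow> i < l \<Longrightarrow> P (window Q i k)) \<Longrightarrow> False"
  shows "1 / q \<le> codegree_turan_density k (tight_cycle_minus k l)"
proof (rule codegree_turan_density_ge)
  have edge: "tight_edge k l i \<in> edges (tight_cycle_minus k l)" if "1 \<le> i" "i < l" for i
    using that tight_edge_neq_first[of i l k] k by (auto simp: tight_cycle_minus_def tight_cycle_def)
  show "edges (tight_cycle_minus k l) \<noteq> {}" using edge[of 1] k by auto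
  show "1 \<le> k" using k by simp
  define col :: "nat set \<Rightarrow> nat multiset" where "col S = image_mset (\<lambda>v. v mod q) (mset_set S)" for S
  fix n assume n: "n \<ge> k"
  define G :: "nat hypergraph" where "G = ({..<n}, {e. e \<subseteq> {..<n} \<and> card e = k \<and> P (col e)})"
  show "1 / q * n - k \<le> codegree_ex k n (tight_cycle_minus k l)"
  proof (rule codegree_ex_ge)
    show "uniform_hypergraph k G" by (simp add: G_def uniform_hypergraph_def)
    show "card (verts G) = n" by (simp add: G_def)
    show "k - 1 \<le> n" using n by simp
  next
    show "\<not> contains_copy G (tight_cycle_minus k l)"
    proof
      assume "contains_copy G (tight_cycle_minus k l)"
      then obtain f where f: "inj_on f {..<l}"
        "\<And>e. e \<in> edges (tight_cycle_minus k l) \<Longrightarrow> f ` e \<in> edges G"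
        unfolding contains_copy_def by (auto simp: tight_cycle_minus_def tight_cycle_def)
      define Q where "Q n = f (n mod l) mod q" for n
      show False
      proof (rule no_cycle)
        show "Q n < q" "Q (n mod l) = Q n" for n using q by (auto simp: Q_def)
        fix i assume i: "1 \<le> i" "i < l"
        have inj1: "inj_on (\<lambda>n. n mod l) {i..<i + k}" by (rule inj_on_mod_interval) (use k in simp)
        have "inj_on f ((\<lambda>n. n mod l) ` {i..<i + k})"
          by (rule inj_on_subset[OF f(1)]) (use k in auto)
        with inj1 have inj: "inj_on (\<lambda>n. f (n mod l)) {i..<i + k}"
          using comp_inj_on[of "\<lambda>n. n mod l" _ f] by (simp add: comp_def)
        have "f ` tight_edge k l i = (\<lambda>n. f (n mod l)) ` {i..<i + k}"
          by (simp add: tight_edge_eq image_image)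
        then have "mset_set (f ` tight_edge k l i) = image_mset (\<lambda>n. f (n mod l)) (mset_set {i..<i + k})"
          using inj by (simp add: image_mset_mset_set)
        then have "col (f ` tight_edge k l i) = window Q i k"
          by (simp add: col_def window_def Q_def[abs_def] multiset.map_comp comp_def)
        moreover have "P (col (f ` tight_edge k l i))" using f(2)[OF edge[OF i]] by (simp add: G_def)
        ultimately show "P (window Q i k)" by simp
      qed
    qed
  next
    fix S assume S: "S \<subseteq> verts G" "card S = k - 1"
    then have Sn: "S \<subseteq> {..<n}" "finite S" by (auto simp: G_def finite_subset)
    have "size (col S) = k - 1" "set_mset (col S) \<subseteq> {..<q}" using S(2) Sn(2) q by (auto simp: col_def)
    then obtain c where c: "c < q" "P (add_mset c (col S))" using extend by blast
    have "{v \<in> {..<n}. v mod q = c} - S \<subseteq> {v \<in> verts G. S \<union> {v} \<in> edges G}"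
      using Sn S(2) c(2) k by (auto simp: G_def col_def)
    then have "card ({v \<in> {..<n}. v mod q = c} - S) \<le> codegree G S"
      unfolding codegree_def by (rule card_mono[rotated]) (simp add: G_def)
    moreover have "card {v \<in> {..<n}. v mod q = c} - card S \<le> card ({v \<in> {..<n}. v mod q = c} - S)"
      using Sn(2) by (rule diff_card_le_card_Diff)
    ultimately have "n div q \<le> codegree G S + (k - 1)"
      using card_residue_class_ge[OF c(1), of n] S(2) by linarith
    then have "real (n div q) \<le> codegree G S + real (k - 1)" by (metis of_nat_add of_nat_le_iff)
    moreover have "real n / real q - 1 \<le> real (n div q)"
    proof -
      have "real (n mod q) / real q \<le> 1" using q by simp
      then show ?thesis using of_nat_of_nat_div_aux[of n q, where ?'a = real] by linarith
    qed
    ultimately show "1 / q * n - k \<le> codegree G S" using k by (simp add: of_nat_diff)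
  qed
qed

section \<open>The lower bound from a prime factor\<close>

lemma exists_completing_residue:
  fixes s q :: nat
  assumes "1 < q" shows "\<exists>c<q. (s + c) mod q = 1"
proof (intro exI conjI)
  let ?c = "(1 + (q - s mod q)) mod q"
  show "?c < q" using assms by simp
  have "s mod q + (1 + (q - s mod q)) = 1 + q" using assms by (simp add: less_imp_le)
  then have "(s + ?c) mod q = (1 + q) mod q" by (metis mod_add_left_eq mod_add_right_eq)
  moreover have "(1 + q) mod q = 1" using assms by (metis mod_add_self2 mod_less)
  ultimately show "(s + ?c) mod q = 1" by simp
qed

text \<open>Two consecutive windows differ only in their end points, so equal sums modulo \<open>q\<close> force equal
  end points when all values are residues modulo \<open>q\<close>.  Hence the links needed for periodicity are
  all present.\<close>

lemma window_of_constant_sum: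
  fixes Q :: "nat \<Rightarrow> nat"
  assumes l: "0 < l" and g: "1 < gcd k l" and k: "k = r * gcd k l" "0 < k"
    and Q: "\<And>n. Q n < q" "\<And>n. Q (n mod l) = Q n"
    and sum: "\<And>i. 1 \<le> i \<Longrightarrow> i < l \<Longrightarrow> sum_mset (window Q i k) mod q = 1"
  shows "window Q i k = repeat_mset r (window Q i (gcd k l))"
proof -
  have "Q (n + gcd k l) = Q n" for n
  proof (rule periodic_of_links[where Q = Q, OF l k(2) g Q(2)])
    fix i assume i: "1 \<le> i" "i + 1 < l"
    have "Q (i + k) + sum_mset (window Q i k) = Q i + sum_mset (window Q (Suc i) k)"
      using arg_cong[OF window_slide[of Q i k], of sum_mset] by simp
    moreover have "[sum_mset (window Q (Suc i) k) = sum_mset (window Q i k)] (mod q)"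
      using sum[of i] sum[of "Suc i"] i by (simp add: Cong.cong_def)
    then have "[Q i + sum_mset (window Q (Suc i) k) = Q i + sum_mset (window Q i k)] (mod q)"
      by (simp only: cong_add_lcancel_nat)
    ultimately have "[Q (i + k) + sum_mset (window Q i k) = Q i + sum_mset (window Q i k)] (mod q)"
      by simp
    then have "[Q (i + k) = Q i] (mod q)" by (simp only: cong_add_rcancel_nat)
    then show "Q (i + k) = Q i" using Q(1) by (simp add: Cong.cong_def)
  qed
  then have "window Q i (r * gcd k l) = repeat_mset r (window Q i (gcd k l))" by (rule window_periodic)
  then show ?thesis unfolding k(1)[symmetric] .
qed

text \<open>The \<open>k\<close>-sets with vertex sum \<open>1\<close> modulo \<open>p\<close> contain no copy: constant sums would make the colour
  multiset of an edge an \<open>r\<close>-fold multiple, whose sum is divisible by \<open>p\<close>.\<close>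

lemma density_ge_inverse_factor:
  fixes k l r p :: nat
  assumes l: "k < l" and g: "1 < gcd k l" and k: "k = r * gcd k l" "0 < k" and p: "1 < p" "p dvd r"
  shows "1 / p \<le> codegree_turan_density k (tight_cycle_minus k l)"
proof (rule density_ge_of_colour_pattern[where P = "\<lambda>X. sum_mset X mod p = 1"])
  show "0 < k" "k < l" "0 < p" using l k(2) p by simp_all
  show "\<exists>c<p. sum_mset (add_mset c X) mod p = 1" for X
    using exists_completing_residue[OF p(1), of "sum_mset X"] by (simp add: add.commute)
next
  fix Q :: "nat \<Rightarrow> nat"
  assume Q: "\<And>n. Q n < p" "\<And>n. Q (n mod l) = Q n"
    and P: "\<And>i. 1 \<le> i \<Longrightarrow> i < l \<Longrightarrow> sum_mset (window Q i k) mod p = 1"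
  have l0: "0 < l" using l by simp
  have "window Q 1 k = repeat_mset r (window Q 1 (gcd k l))"
    by (rule window_of_constant_sum[where Q = Q, OF l0 g k Q P])
  then have "sum_mset (window Q 1 k) = r * sum_mset (window Q 1 (gcd k l))"
    by (simp only: sum_mset_repeat_mset)
  then have "p dvd sum_mset (window Q 1 k)" using p(2) by simp
  moreover have "sum_mset (window Q 1 k) mod p = 1" using P[of 1] l k(2) by simp
  ultimately show False by simp
qed


section \<open>Repairing a colour multiset\<close>

text \<open>Here \<open>A\<close> is the set of colours of \<open>M\<close>.  The constant step \<open>1\<close> keeps different repairs of the
  same \<open>M\<close> apart, but \<open>exists_cut\<close> needs a colour missing from \<open>A\<close> other than \<open>c + 1\<close>.  When there is
  none, the step \<open>2\<close> avoids \<open>c + 1\<close>.\<close>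

definition repair_step :: "nat \<Rightarrow> nat set \<Rightarrow> nat \<Rightarrow> nat" where
  "repair_step t A c = (if A = {..<t} - {(c + 1) mod t} then 2 else 1)"

definition repair :: "nat \<Rightarrow> nat set \<Rightarrow> nat \<Rightarrow> nat" where
  "repair t A c = (c + repair_step t A c) mod t"

lemma repair_step_cases: "repair_step t A c = 1 \<or> repair_step t A c = 2"
  by (simp add: repair_step_def)

lemma add_mod_cancel_right:
  fixes a b c t :: nat
  assumes "(a + c) mod t = (b + c) mod t" "a < t" "b < t" shows "a = b"
proof -
  have "[a + c = b + c] (mod t)" using assms(1) by (simp add: Cong.cong_def)
  then have "[a = b] (mod t)" by (simp add: cong_add_rcancel_nat)
  then show ?thesis using assms by (simp add: Cong.cong_def)
qed

lemma add_mod_neq_self: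
  fixes a d t :: nat
  assumes "a < t" "0 < d" "d < t" shows "(a + d) mod t \<noteq> a"
proof
  assume "(a + d) mod t = a"
  then have "(d + a) mod t = (0 + a) mod t" using assms(1) by (simp add: add.commute)
  from add_mod_cancel_right[OF this] assms show False by simp
qed

lemma repair_neq: "2 < t \<Longrightarrow> c < t \<Longrightarrow> repair t A c \<noteq> c"
  unfolding repair_def by (rule add_mod_neq_self) (use repair_step_cases[of t A c] in auto)

lemma repair_less: "0 < t \<Longrightarrow> repair t A c < t"
  by (simp add: repair_def)

text \<open>Equal images with different steps would have \<open>a + 1 = b + 2\<close>, so \<open>a = b + 1\<close> would be the colour
  missing from \<open>A\<close>.\<close>

lemma repair_inj:
  assumes "2 < t" "A \<subseteq> {..<t}" "c \<in> A" "y \<in> A" "repair t A c = repair t A y"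
  shows "c = y"
proof -
  have lt: "c < t" "y < t" using assms by auto
  have aux: False if "a \<in> A" "b \<in> A" "repair_step t A a = 1" "repair_step t A b = 2"
    "repair t A a = repair t A b" for a b
  proof -
    have "(a + 1) mod t = (b + 2) mod t" using that by (simp add: repair_def)
    then have "(a + 1) mod t = ((b + 1) mod t + 1) mod t" by (simp add: mod_simps)
    moreover have "a < t" "(b + 1) mod t < t" using that assms by auto
    ultimately have "a = (b + 1) mod t" using add_mod_cancel_right by blast
    moreover have "A = {..<t} - {(b + 1) mod t}" using that(4) by (auto simp: repair_step_def split: if_splits)
    ultimately show False using that(1) by auto
  qed
  have "repair_step t A c = repair_step t A y"
    using aux[of c y] aux[of y c] assms repair_step_cases[of t A c] repair_step_cases[of t A y] by metis
  then have "(c + repair_step t A c) mod t = (y + repair_step t A c) mod t"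
    using assms(5) by (simp add: repair_def)
  then show ?thesis using lt add_mod_cancel_right by blast
qed

text \<open>The steps are \<open>1\<close> or \<open>2\<close>, so they can only cancel modulo an odd \<open>t\<close> when \<open>t = 3\<close> and one of them is
  \<open>2\<close>.  Then \<open>A\<close> has just two elements, and the repair with step \<open>2\<close> maps one to the other.\<close>

lemma repair_steps_not_opposite:
  assumes t: "2 < t" "odd t" and A: "A \<subseteq> {..<t}" "c \<in> A" "y \<in> A" "c \<noteq> y"
    and no: "y \<noteq> repair t A c" "c \<noteq> repair t A y"
  shows "\<not> t dvd repair_step t A c + repair_step t A y"
proof
  assume dvd: "t dvd repair_step t A c + repair_step t A y"
  let ?s = "repair_step t A c + repair_step t A y"
  have "?s \<noteq> 4"
  proof
    assume "?s = 4"
    then have "t dvd 4" using dvd by simp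
    then have "t \<le> 4" by (rule dvd_imp_le) simp
    then have "t = 3 \<or> t = 4" using t(1) by linarith
    then have "t = 3" using t(2) by auto
    then show False using \<open>t dvd 4\<close> by simp
  qed
  moreover have "?s \<noteq> 2" using dvd t(1) by (auto dest: dvd_imp_le)
  moreover have "?s = 2 \<or> ?s = 3 \<or> ?s = 4" using repair_step_cases[of t A c] repair_step_cases[of t A y] by auto
  ultimately have s: "?s = 3" by blast
  then have t3: "t = 3" using dvd t dvd_imp_le[of t 3] by auto
  have aux: "b = repair t A a" if "a \<in> A" "b \<in> A" "a \<noteq> b" "repair_step t A a = 2" for a b
  proof -
    have "A = {..<t} - {(a + 1) mod t}" using that(4) by (auto simp: repair_step_def split: if_splits)
    then have "b < 3" "a < 3" "b \<noteq> (a + 1) mod 3" using that A(1) t3 by auto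
    then have "a = 0 \<or> a = 1 \<or> a = 2" "b = 0 \<or> b = 1 \<or> b = 2" by linarith+
    then have "b = (a + 2) mod 3" using that(3) \<open>b \<noteq> (a + 1) mod 3\<close> by auto
    then show ?thesis using that(4) t3 by (simp add: repair_def)
  qed
  show False using aux[of c y] aux[of y c] s A no repair_step_cases[of t A c] repair_step_cases[of t A y] by auto
qed

lemma offset_shift:
  fixes z t :: nat
  shows "((v + d) mod t + (t - z)) mod t = ((v + (t - z)) mod t + d) mod t"
  by (simp add: mod_simps ac_simps)

lemma offset_inj:
  fixes z t :: nat
  assumes "(x + (t - z)) mod t = (y + (t - z)) mod t" "x < t" "y < t" shows "x = y"
  using add_mod_cancel_right assms by blast

text \<open>Arrange the colours on a circle in steps of the repair step, starting at \<open>c\<close>.  The set \<open>W\<close> is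
  the arc from \<open>repair t A c\<close> up to just before a colour \<open>z\<close> missing from \<open>A\<close>.  A step into \<open>u\<close> crosses
  the boundary of \<open>W\<close> only if \<open>u\<close> is one of the two excluded colours.\<close>

lemma exists_cut:
  assumes t: "2 < t" "odd t" and A: "A \<subset> {..<t}" "c \<in> A"
  obtains W where "repair t A c \<in> W" "c \<notin> W"
    "\<And>u v. u \<in> A \<Longrightarrow> u \<noteq> repair t A c \<Longrightarrow> v < t \<Longrightarrow> (v + repair_step t A c) mod t = u \<Longrightarrow>
       (u \<in> W \<longleftrightarrow> v \<in> W)"
proof (cases "A = {..<t} - {(c + 1) mod t}")
  case True
  have step: "repair_step t A c = 2" using True by (simp add: repair_step_def)
  have ct: "c < t" using A by auto
  define z where "z = (c + 1) mod t"
  define off where "off x = (x + (t - z)) mod t" for x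
  have zt: "z < t" using t by (simp add: z_def)
  have off_add: "off ((v + d) mod t) = (off v + d) mod t" for v d
    unfolding off_def by (rule offset_shift)
  have off_z: "off z = 0" using zt by (simp add: off_def)
  have off_inj: "off x = off y \<Longrightarrow> x < t \<Longrightarrow> y < t \<Longrightarrow> x = y" for x y
    unfolding off_def by (rule offset_inj)
  have off_lt: "off x < t" for x using t by (simp add: off_def)
  have "repair t A c = (z + 1) mod t" unfolding repair_def step z_def by (simp add: mod_simps)
  then have off_r: "off (repair t A c) = 1" using off_add[of z 1] off_z t by simp
  have "(off c + 1) mod t = 0" using off_add[of c 1] off_z by (simp add: z_def)
  then have off_c: "off c = t - 1" using off_lt[of c] t by (auto simp: mod_Suc split: if_splits)
  \<comment> \<open>Seen from the missing colour \<open>z = c + 1\<close>, the arc in steps of \<open>2\<close> consists of the odd offsets; this uses that \<open>t\<close> is odd.\<close>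
  show thesis
  proof (rule that[of "{x. odd (off x)}"])
    show "repair t A c \<in> {x. odd (off x)}" using off_r by simp
    show "c \<notin> {x. odd (off x)}" using off_c t by simp
    fix u v assume u: "u \<in> A" "u \<noteq> repair t A c" "v < t" "(v + repair_step t A c) mod t = u"
    have ut: "u < t" using u A by auto
    have "off u \<noteq> 0" using off_inj[of u z] off_z ut zt u(1) True by (auto simp: z_def)
    moreover have "off u \<noteq> 1" using off_inj[of u "repair t A c"] off_r ut u(2) t by (auto simp: repair_def)
    moreover have "off u = (off v + 2) mod t" using off_add[of v 2] u(4) step by simp
    moreover have "(off v + 2) mod t = (if off v + 2 < t then off v + 2 else off v + 2 - t)"
      using off_lt[of v] t by (auto simp: mod_if)
    ultimately have "off u = off v + 2" using off_lt[of v] by (auto split: if_splits)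
    then show "u \<in> {x. odd (off x)} \<longleftrightarrow> v \<in> {x. odd (off x)}" by simp
  qed
next
  case False
  have step: "repair_step t A c = 1" using False by (simp add: repair_step_def)
  have ct: "c < t" using A by auto
  obtain z where z: "z < t" "z \<notin> A" "z \<noteq> (c + 1) mod t"
    using False A(1) by blast
  define off where "off x = (x + (t - c)) mod t" for x
  have off_add: "off ((v + d) mod t) = (off v + d) mod t" for v d
    unfolding off_def by (rule offset_shift)
  have off_c: "off c = 0" using ct by (simp add: off_def)
  have off_inj: "off x = off y \<Longrightarrow> x < t \<Longrightarrow> y < t \<Longrightarrow> x = y" for x y
    unfolding off_def by (rule offset_inj)
  have off_lt: "off x < t" for x using t by (simp add: off_def)
  have r: "repair t A c = (c + 1) mod t" by (simp add: repair_def step)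
  then have off_r: "off (repair t A c) = 1" using off_add[of c 1] off_c t by simp
  have "off z \<noteq> 0" using off_inj[of z c] off_c z A ct by auto
  moreover have "off z \<noteq> 1" using off_inj[of z "repair t A c"] off_r z t r by auto
  ultimately have off_z: "2 \<le> off z" by simp
  show thesis
  proof (rule that[of "{x. 1 \<le> off x \<and> off x < off z}"])
    show "repair t A c \<in> {x. 1 \<le> off x \<and> off x < off z}" using off_r off_z by simp
    show "c \<notin> {x. 1 \<le> off x \<and> off x < off z}" using off_c by simp
    fix u v assume u: "u \<in> A" "u \<noteq> repair t A c" "v < t" "(v + repair_step t A c) mod t = u"
    have ut: "u < t" using u A by auto
    have "off u \<noteq> off z" using off_inj[of u z] ut z u(1) by auto
    moreover have "off u \<noteq> 1" using off_inj[of u "repair t A c"] off_r ut u(2) t by (auto simp: repair_def)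
    moreover have "off u = (off v + 1) mod t" using off_add[of v 1] u(4) step by simp
    moreover have "(off v + 1) mod t = (if off v + 1 < t then off v + 1 else 0)"
      using off_lt[of v] by (auto simp: mod_if)
    ultimately show "u \<in> {x. 1 \<le> off x \<and> off x < off z} \<longleftrightarrow> v \<in> {x. 1 \<le> off x \<and> off x < off z}"
      using off_lt[of v] off_lt[of z] by (auto split: if_splits)
  qed
qed

text \<open>Compare multiplicities modulo \<open>r\<close>.  This recovers \<open>M\<close> and the small deviation from an \<open>r\<close>-fold
  multiple; the deviations in \<open>cluster_step\<close> have size at most \<open>4\<close>, whence \<open>r \<ge> 5\<close> there.\<close>

lemma repeat_mset_add_unique:
  assumes "repeat_mset r M + X = repeat_mset r N + Y" "size X < r" "size Y < r"
  shows "M = N \<and> X = Y"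
proof -
  have "count M x = count N x \<and> count X x = count Y x" for x
  proof -
    have eq: "r * count M x + count X x = r * count N x + count Y x"
      using arg_cong[OF assms(1), of "\<lambda>Z. count Z x"] by simp
    have lt: "count X x < r" "count Y x < r" using assms(2,3) count_le_size[of X x] count_le_size[of Y x] by linarith+
    have "(r * count M x + count X x) mod r = count X x" "(r * count N x + count Y x) mod r = count Y x"
      using lt by simp_all
    then have "count X x = count Y x" using eq by simp
    then show ?thesis using eq lt by auto
  qed
  then show ?thesis by (simp add: multiset_eq_iff)
qed

text \<open>The multisets selected by the sum condition, without the \<open>r\<close>-fold multiples that a periodic
  sequence would produce.\<close>

definition plain :: "nat \<Rightarrow> nat \<Rightarrow> nat multiset \<Rightarrow> bool" where
  "plain r t X \<longleftrightarrow> sum_mset X mod t = 1 \<and> (\<nexists>M. X = repeat_mset r M)"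

text \<open>The multiset \<open>r M - c + c'\<close>, stated without subtraction.\<close>

definition repaired :: "nat \<Rightarrow> nat \<Rightarrow> nat multiset \<Rightarrow> nat \<Rightarrow> nat multiset \<Rightarrow> bool" where
  "repaired r t M c X \<longleftrightarrow> c \<in># M \<and> set_mset M \<subset> {..<t} \<and> sum_mset (repeat_mset r M) mod t = 1 \<and>
     add_mset c X = add_mset (repair t (set_mset M) c) (repeat_mset r M)"

text \<open>All multisets that a walk can reach once it has visited \<open>r M - c + c'\<close>: that multiset and its
  plain neighbours, in which some \<open>y\<close> of \<open>M\<close> is lowered by the repair step to \<open>v\<close>.\<close>

definition cluster :: "nat \<Rightarrow> nat \<Rightarrow> nat multiset \<Rightarrow> nat \<Rightarrow> nat multiset \<Rightarrow> bool" where
  "cluster r t M c X \<longleftrightarrow> repaired r t M c X \<or>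
     plain r t X \<and> (\<exists>y v. y \<in># M \<and> y \<noteq> repair t (set_mset M) c \<and> v < t \<and>
       (v + repair_step t (set_mset M) c) mod t = y \<and>
       add_mset c (add_mset y X) = add_mset (repair t (set_mset M) c) (add_mset v (repeat_mset r M)))"

lemma repaired_sum:
  assumes "repaired r t M c X"
  shows "[sum_mset X = 1 + repair_step t (set_mset M) c] (mod t)"
proof -
  let ?d = "repair_step t (set_mset M) c"
  have "add_mset c X = add_mset (repair t (set_mset M) c) (repeat_mset r M)"
    using assms by (simp add: repaired_def)
  from arg_cong[OF this, of sum_mset]
  have "c + sum_mset X = repair t (set_mset M) c + sum_mset (repeat_mset r M)" by simp
  also have "[\<dots> = (c + ?d) + 1] (mod t)"
    using assms by (intro cong_add) (auto simp: repaired_def repair_def Cong.cong_def)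
  also have "(c + ?d) + 1 = c + (1 + ?d)" by simp
  finally show ?thesis by (simp only: cong_add_lcancel_nat)
qed

lemma add_eq_add_disjoint:
  assumes eq: "P + R = P' + R'" and disj: "set_mset P \<inter> set_mset R' = {}" "set_mset R \<inter> set_mset P' = {}"
  shows "P = P' \<and> R = R'"
proof -
  have "count P x = count P' x \<and> count R x = count R' x" for x
  proof -
    have "count P x + count R x = count P' x + count R' x" using arg_cong[OF eq, of "\<lambda>Z. count Z x"] by simp
    moreover have "count P x = 0 \<or> count R' x = 0" "count R x = 0 \<or> count P' x = 0"
      using disj by (auto simp: count_eq_zero_iff)
    ultimately show ?thesis by auto
  qed
  then show ?thesis by (simp add: multiset_eq_iff)
qed

text \<open>One window slides to the next by exchanging \<open>u\<close> for \<open>v\<close>.  Comparing sums determines \<open>v - u\<close>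
  modulo \<open>t\<close>, and comparing deviations from \<open>r\<close>-fold multiples identifies the multiset that is
  reached.  A second repaired multiset next to the same plain one would need either two colours with the same repair
  or two opposite repair steps.\<close>

lemma cluster_step:
  assumes r: "5 \<le> r" and t: "2 < t" "odd t"
    and X: "cluster r t M c X"
    and X': "plain r t X' \<or> (\<exists>N b. repaired r t N b X')"
    and slide: "add_mset v X = add_mset u X'" and uv: "u < t" "v < t"
    and cut: "\<And>u v. u \<in># M \<Longrightarrow> u \<noteq> repair t (set_mset M) c \<Longrightarrow> v < t \<Longrightarrow>
       (v + repair_step t (set_mset M) c) mod t = u \<Longrightarrow> (u \<in> W \<longleftrightarrow> v \<in> W)"
    and c: "c \<in># M" "set_mset M \<subset> {..<t}"
  shows "cluster r t M c X' \<and> (u \<in> W \<longleftrightarrow> v \<in> W)"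
proof -
  define e where "e = repair t (set_mset M) c"
  define d where "d = repair_step t (set_mset M) c"
  have ce: "c \<noteq> e" "e < t" "c < t" "e = (c + d) mod t"
    using c t repair_neq[of t c "set_mset M"] repair_less[of t] by (auto simp: e_def d_def repair_def)
  have d: "0 < d" "d < t" using repair_step_cases[of t "set_mset M" c] t by (auto simp: d_def)
  have sums: "v + sum_mset X = u + sum_mset X'" using arg_cong[OF slide, of sum_mset] by simp
  show ?thesis
  proof (cases "u = v")
    case True
    then show ?thesis using X slide by simp
  next
    case False
    from X consider
        (base) "repaired r t M c X"
      | (near) y w where "plain r t X" "y \<in># M" "y \<noteq> e" "w < t" "(w + d) mod t = y"
          "add_mset c (add_mset y X) = add_mset e (add_mset w (repeat_mset r M))"
      unfolding cluster_def e_def d_def by blast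
    then show ?thesis
    proof cases
      case base
      have eq: "add_mset c X = add_mset e (repeat_mset r M)" using base by (simp add: repaired_def e_def)
      have sX: "[sum_mset X = 1 + d] (mod t)" using repaired_sum[OF base] by (simp add: d_def)
      from X' show ?thesis
      proof
        assume P: "plain r t X'"
        then have "[sum_mset X' = 1] (mod t)" using t by (simp add: plain_def Cong.cong_def)
        then have "[u + sum_mset X' = u + 1] (mod t)" by (simp only: cong_add_lcancel_nat)
        moreover have "[v + sum_mset X = v + (1 + d)] (mod t)" using sX by (simp only: cong_add_lcancel_nat)
        ultimately have "[v + (1 + d) = u + 1] (mod t)" using sums by (metis cong_sym cong_trans)
        then have "[(v + d) + 1 = u + 1] (mod t)" by (simp add: ac_simps)
        then have "[v + d = u] (mod t)" by (simp only: cong_add_rcancel_nat)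
        then have vd: "(v + d) mod t = u" using uv by (simp add: Cong.cong_def)
        \<comment> \<open>Undoing the repair would give \<open>r M\<close> itself, which is not plain.\<close>
        have ue: "u \<noteq> e"
        proof
          assume "u = e"
          then have "v = c" using vd ce uv add_mod_cancel_right by metis
          then have "X' = repeat_mset r M" using slide eq \<open>u = e\<close> by simp
          then show False using P by (auto simp: plain_def)
        qed
        have "u \<in># X" using slide False by (metis insert_noteq_member)
        then have "u \<in># add_mset c X" by simp
        then have "u \<in># add_mset e (repeat_mset r M)" unfolding eq .
        then have "u \<in># repeat_mset r M" using ue by simp
        then have uM: "u \<in># M" using r set_mset_repeat_mset[of r M] by simp
        have "add_mset c (add_mset u X') = add_mset e (add_mset v (repeat_mset r M))"
          using slide eq by (metis add_mset_commute)
        then have "cluster r t M c X'" unfolding cluster_def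
          using P uM ue uv vd unfolding e_def d_def by blast
        then show ?thesis using cut[of u v] uM ue uv vd by (simp add: e_def d_def)
      next
        assume "\<exists>N b. repaired r t N b X'"
        then obtain N b where R: "repaired r t N b X'" by blast
        define f where "f = repair t (set_mset N) b"
        have bN: "b \<in># N" "set_mset N \<subset> {..<t}" "add_mset b X' = add_mset f (repeat_mset r N)"
          using R by (auto simp: repaired_def f_def)
        have bf: "b \<noteq> f" using bN t repair_neq[of t b "set_mset N"] by (auto simp: f_def)
        have "repeat_mset r M + {#e, v, b#} = add_mset v (add_mset b (add_mset c X))" using eq by simp
        also have "\<dots> = add_mset b (add_mset c (add_mset u X'))" using slide by simp
        also have "\<dots> = repeat_mset r N + {#f, u, c#}" using bN(3) by (simp add: add_mset_commute)
        finally have "M = N \<and> {#e, v, b#} = {#f, u, c#}"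
          by (rule repeat_mset_add_unique) (use r in auto)
        then have MN: "M = N" and set3: "{#e, v, b#} = {#f, u, c#}" by auto
        show ?thesis
        proof (cases "b = c")
          case True
          then have "e = f" using MN by (simp add: e_def f_def)
          then have False using set3 True \<open>u \<noteq> v\<close> by simp
          then show ?thesis ..
        next
          case False
          have "b \<in># {#f, u, c#}" unfolding set3[symmetric] by simp
          then have "b = u" using False bf by auto
          then have "{#e, v#} = {#f, c#}" using set3 by (simp add: add_mset_commute)
          then have "e = f" using ce(1) by (auto simp: pair_mset_eq_iff)
          then have "repair t (set_mset M) c = repair t (set_mset M) b" unfolding e_def f_def MN .
          then have "c = b" by (rule repair_inj[rotated -1]) (use t c bN(1) MN in auto)
          then show ?thesis using False by simp
        qed
      qed
    next
      case near
      have yt: "y < t" using near(2) c by auto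
      have wy: "w \<noteq> y" using near(5) near(4) d add_mod_neq_self by blast
      have wc: "w \<noteq> c" using near(5) near(3) ce(4) by auto
      have sX: "[sum_mset X = 1] (mod t)" using near(1) t by (simp add: plain_def Cong.cong_def)
      from X' show ?thesis
      proof
        assume P: "plain r t X'"
        then have "[sum_mset X = sum_mset X'] (mod t)" using near(1) by (simp add: plain_def Cong.cong_def)
        then have "[v + sum_mset X = v + sum_mset X'] (mod t)" by (simp only: cong_add_lcancel_nat)
        then have "[u + sum_mset X' = v + sum_mset X'] (mod t)" using sums by simp
        then have "[u = v] (mod t)" by (simp only: cong_add_rcancel_nat)
        then show ?thesis using uv False by (simp add: Cong.cong_def)
      next
        assume "\<exists>N b. repaired r t N b X'"
        then obtain N b where R: "repaired r t N b X'" by blast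
        define f where "f = repair t (set_mset N) b"
        define d2 where "d2 = repair_step t (set_mset N) b"
        have bN: "b \<in># N" "set_mset N \<subset> {..<t}" "add_mset b X' = add_mset f (repeat_mset r N)"
          using R by (auto simp: repaired_def f_def)
        have bt: "b < t" using bN by auto
        have bf: "b \<noteq> f" "f = (b + d2) mod t" using bN t repair_neq[of t b "set_mset N"] by (auto simp: f_def d2_def repair_def)
        have "[sum_mset X' = 1 + d2] (mod t)" using repaired_sum[OF R] by (simp add: d2_def)
        then have "[u + sum_mset X' = u + (1 + d2)] (mod t)" by (simp only: cong_add_lcancel_nat)
        moreover have "[v + sum_mset X = v + 1] (mod t)" using sX by (simp only: cong_add_lcancel_nat)
        ultimately have "[u + (1 + d2) = v + 1] (mod t)" using sums by (metis cong_sym cong_trans)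
        then have "[(u + d2) + 1 = v + 1] (mod t)" by (simp add: ac_simps)
        then have "[u + d2 = v] (mod t)" by (simp only: cong_add_rcancel_nat)
        then have ud: "(u + d2) mod t = v" using uv by (simp add: Cong.cong_def)
        \<comment> \<open>As above, with the roles of the two windows exchanged.\<close>
        have vf: "v \<noteq> f"
        proof
          assume "v = f"
          then have "u = b" using ud bf bt uv add_mod_cancel_right by metis
          then have "X = repeat_mset r N" using slide bN(3) \<open>v = f\<close> by simp
          then show False using near(1) by (auto simp: plain_def)
        qed
        have ub: "u \<noteq> b" using ud bf(2) vf by auto
        have "repeat_mset r M + {#e, w, v, b#} = add_mset v (add_mset b (add_mset c (add_mset y X)))"
          using near(6) by simp
        also have "\<dots> = add_mset b (add_mset c (add_mset y (add_mset u X')))"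
          using slide by simp
        also have "\<dots> = add_mset u (add_mset c (add_mset y (add_mset b X')))"
          by (simp add: add_mset_commute)
        also have "\<dots> = repeat_mset r N + {#f, u, c, y#}" unfolding bN(3) by (simp add: add_mset_commute)
        finally have "M = N \<and> {#e, w, v, b#} = {#f, u, c, y#}"
          by (rule repeat_mset_add_unique) (use r in auto)
        then have MN: "M = N" and set4: "{#e, w, v, b#} = {#f, u, c, y#}" by auto
        have split: "{#p, q#} + {#x, z#} = {#p, q, x, z#}" for p q x z :: nat
          by (simp add: multiset_eq_iff)
        have sum4: "{#e, w#} + {#v, b#} = {#f, u#} + {#c, y#}" using set4 by (simp only: split)
        have pairs: "{#e, w#} = {#f, u#} \<and> {#v, b#} = {#c, y#}"
          by (rule add_eq_add_disjoint[OF sum4]) (use ce near wy wc vf ub bf False in auto)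
        show ?thesis
        proof (cases "b = c")
          \<comment> \<open>The walk returns to the repaired multiset it came from, by the reverse exchange.\<close>
          case True
          then have "e = f" using MN by (simp add: e_def f_def)
          then have wu: "w = u" and vy: "v = y" using pairs True by (auto simp: pair_mset_eq_iff)
          have "repaired r t M c X'" using R True MN by simp
          then show ?thesis using cut[of y w] near wu vy by (auto simp: cluster_def e_def d_def)
        next
          \<comment> \<open>The plain multiset would lie between the repaired multisets of two colours \<open>c\<close> and \<open>y\<close>.\<close>
          case False
          then have byc: "b = y" "v = c" using pairs by (auto simp: pair_mset_eq_iff)
          have "e \<noteq> f"
          proof
            assume "e = f"
            then have "repair t (set_mset M) c = repair t (set_mset M) b" unfolding e_def f_def MN .
            then have "c = b" by (rule repair_inj[rotated -1]) (use t c bN(1) MN in auto)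
            then show False using False by simp
          qed
          then have wf: "w = f" "u = e" using pairs by (auto simp: pair_mset_eq_iff)
          have "(y + (d2 + d)) mod t = y" using near(5) wf(1) bf(2) byc(1) by (simp add: mod_simps ac_simps)
          then have "[y + (d2 + d) = y + 0] (mod t)" using yt by (simp add: Cong.cong_def)
          then have "[d2 + d = 0] (mod t)" by (simp only: cong_add_lcancel_nat)
          then have "t dvd d + d2" by (simp add: cong_0_iff add.commute)
          moreover have "\<not> t dvd d + d2"
            unfolding d_def d2_def MN[symmetric] byc(1)
          proof (rule repair_steps_not_opposite)
            show "y \<noteq> repair t (set_mset M) c" using near(3) by (simp add: e_def)
            show "c \<noteq> repair t (set_mset M) y" using vf byc by (simp add: f_def MN)
            show "c \<noteq> y" using False byc(1) by simp
          qed (use t c near in auto)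
          ultimately show ?thesis by simp
        qed
      qed
    qed
  qed
qed

section \<open>The lower bound from an odd number of colours\<close>

definition colour_pattern :: "nat \<Rightarrow> nat \<Rightarrow> nat multiset \<Rightarrow> bool" where
  "colour_pattern r t X \<longleftrightarrow> plain r t X \<or> (\<exists>M c. repaired r t M c X)"

text \<open>A multiset with at most \<open>t\<close> elements that uses all \<open>t\<close> colours uses each once, and the sum of
  all colours is divisible by \<open>t\<close> as \<open>t\<close> is odd.\<close>

lemma proper_support:
  assumes t: "odd t" "2 < t" and M: "set_mset M \<subseteq> {..<t}" "size M \<le> t"
    and sum: "sum_mset (repeat_mset r M) mod t = 1"
  shows "set_mset M \<subset> {..<t}"
proof -
  have "set_mset M \<noteq> {..<t}"
  proof
    assume full: "set_mset M = {..<t}"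
    have sub: "mset_set {..<t} \<subseteq># M"
      unfolding full[symmetric] by (rule mset_set_set_mset_msubset)
    have "M = mset_set {..<t}"
      using sub M(2) mset_subset_size[of "mset_set {..<t}" M] by (auto simp: subset_mset.less_le)
    then have "sum_mset M = \<Sum>{..<t}" by (simp add: sum_unfold_sum_mset)
    also have "\<dots> = (t - 1) div 2 * t"
    proof -
      obtain j where j: "t = 2 * j + 1" using t(1) by (auto elim: oddE)
      have "\<Sum>{..<t} = \<Sum>{0..2 * j}" unfolding j by (rule sum.cong) auto
      then show ?thesis using gauss_sum_nat[of "2 * j"] j by simp
    qed
    finally have "t dvd sum_mset (repeat_mset r M)" by (simp add: sum_mset_repeat_mset)
    then show False using sum t by simp
  qed
  then show ?thesis using M(1) by blast
qed

lemma colour_pattern_extend: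
  assumes t: "odd t" "2 < t" and r: "0 < r" and g: "0 < g" "g \<le> t"
    and X: "size X = r * g - 1" "set_mset X \<subseteq> {..<t}"
  shows "\<exists>c<t. colour_pattern r t (add_mset c X)"
proof -
  obtain c where ct: "c < t" and "(sum_mset X + c) mod t = 1"
    using exists_completing_residue[of t "sum_mset X"] t by auto
  then have sum: "sum_mset (add_mset c X) mod t = 1" by (simp add: add.commute)
  show ?thesis
  proof (cases "\<exists>M. add_mset c X = repeat_mset r M")
    case False
    then have "colour_pattern r t (add_mset c X)" using sum by (simp add: colour_pattern_def plain_def)
    then show ?thesis using ct by blast
  next
    case True
    then obtain M where M: "add_mset c X = repeat_mset r M" by blast
    have "r * size M = size (add_mset c X)" unfolding M by simp
    also have "\<dots> = r * g" using X(1) r g(1) by simp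
    finally have sM: "size M = g" using r by simp
    have set_M: "set_mset M = insert c (set_mset X)"
      using set_mset_repeat_mset[OF r, of M] unfolding M[symmetric] by simp
    then have supp: "set_mset M \<subseteq> {..<t}" using X(2) ct by auto
    have sumM: "sum_mset (repeat_mset r M) mod t = 1" using sum unfolding M .
    have "c \<in># M" using set_M by simp
    moreover have "set_mset M \<subset> {..<t}" by (rule proper_support[OF t supp _ sumM]) (use sM g in simp)
    ultimately have "repaired r t M c (add_mset (repair t (set_mset M) c) X)"
      using sumM M by (simp add: repaired_def add_mset_commute)
    moreover have "repair t (set_mset M) c < t" using t by (simp add: repair_def)
    ultimately show ?thesis unfolding colour_pattern_def by blast
  qed
qed

text \<open>Without repaired windows the sum argument applies and yields a forbidden \<open>r\<close>-fold multiple.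
  Otherwise all windows lie in the cluster of one repaired window.  The slide relation is symmetric
  in the two windows, so \<open>cluster_step\<close> propagates the cluster in both directions.\<close>

lemma colour_pattern_no_cycle:
  assumes kl: "k < l" and g: "1 < gcd k l" and k: "k = r * gcd k l" "0 < k"
    and t: "2 < t" "odd t" and r: "5 \<le> r"
    and Q: "\<And>n. Q n < t" "\<And>n. Q (n mod l) = Q n"
    and P: "\<And>i. 1 \<le> i \<Longrightarrow> i < l \<Longrightarrow> colour_pattern r t (window Q i k)"
  shows False
proof (cases "\<exists>i M c. 1 \<le> i \<and> i < l \<and> repaired r t M c (window Q i k)")
  case False
  then have plain: "plain r t (window Q i k)" if "1 \<le> i" "i < l" for i
    using P that by (auto simp: colour_pattern_def)
  have l0: "0 < l" using kl by simp
  have "window Q 1 k = repeat_mset r (window Q 1 (gcd k l))"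
    by (rule window_of_constant_sum[where Q = Q, OF l0 g k Q]) (use plain in \<open>auto simp: plain_def\<close>)
  then show False using plain[of 1] kl k(2) by (auto simp: plain_def)
next
  case True
  then obtain j M c where j: "1 \<le> j" "j < l" and R: "repaired r t M c (window Q j k)" by blast
  define e where "e = repair t (set_mset M) c"
  have c: "c \<in># M" "set_mset M \<subset> {..<t}" and eq: "add_mset c (window Q j k) = add_mset e (repeat_mset r M)"
    using R by (auto simp: repaired_def e_def)
  obtain W where W: "e \<in> W" "c \<notin> W" and cut: "\<And>u v. u \<in># M \<Longrightarrow> u \<noteq> repair t (set_mset M) c \<Longrightarrow> v < t \<Longrightarrow>
       (v + repair_step t (set_mset M) c) mod t = u \<Longrightarrow> (u \<in> W \<longleftrightarrow> v \<in> W)"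
    using exists_cut[OF t c(2,1)] unfolding e_def by metis
  have step: "cluster r t M c Y \<and> (u \<in> W \<longleftrightarrow> v \<in> W)"
    if "cluster r t M c X" "colour_pattern r t Y" "add_mset v X = add_mset u Y" "u < t" "v < t" for X Y u v
    using that unfolding colour_pattern_def by (intro cluster_step[OF r t _ _ _ _ _ cut c]) auto
  have forward: "cluster r t M c (window Q (Suc i) k) \<and> (Q i \<in> W \<longleftrightarrow> Q (i + k) \<in> W)"
    if "cluster r t M c (window Q i k)" "1 \<le> i" "i + 1 < l" for i
    using step[OF that(1) _ window_slide] P[of "Suc i"] Q(1) that by simp
  have backward: "cluster r t M c (window Q i k)"
    if "cluster r t M c (window Q (Suc i) k)" "1 \<le> i" "i + 1 < l" for i
    using step[OF that(1) _ window_slide[symmetric]] P[of i] Q(1) that by simp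
  have base: "cluster r t M c (window Q j k)" using R by (simp add: cluster_def)
  have up: "cluster r t M c (window Q i k)" if "j \<le> i" "i < l" for i
    using that by (induction i rule: dec_induct) (use base forward j in auto)
  have down: "cluster r t M c (window Q i k)" if "i \<le> j" "1 \<le> i" for i
    using that by (induction i rule: inc_induct) (use base backward j in auto)
  have all: "cluster r t M c (window Q i k)" if "1 \<le> i" "i < l" for i
    using up down that by (meson nle_le)
  have l0: "0 < l" using kl by simp
  have "(Q (n + gcd k l) \<in> W) = (Q n \<in> W)" for n
    by (rule periodic_of_links[OF l0 k(2) g]) (use forward[OF all] Q in auto)
  then have "window (\<lambda>n. Q n \<in> W) j (r * gcd k l) = repeat_mset r (window (\<lambda>n. Q n \<in> W) j (gcd k l))"
    by (rule window_periodic)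
  then have per: "window (\<lambda>n. Q n \<in> W) j k = repeat_mset r (window (\<lambda>n. Q n \<in> W) j (gcd k l))"
    unfolding k(1)[symmetric] .
  let ?h = "\<lambda>x. x \<in> W"
  have "add_mset False (window (\<lambda>n. Q n \<in> W) j k) = add_mset True (repeat_mset r (image_mset ?h M))"
    using arg_cong[OF eq, of "image_mset ?h"] W by (simp add: image_window image_mset_repeat_mset)
  then have "repeat_mset r (window (\<lambda>n. Q n \<in> W) j (gcd k l)) + {#False#} = repeat_mset r (image_mset ?h M) + {#True#}"
    unfolding per by simp
  then have "{#False#} = {#True#}" using repeat_mset_add_unique[of r] r by fastforce
  then show False by simp
qed

lemma density_ge_inverse_odd:
  fixes k l r t :: nat
  assumes l: "k < l" and g: "1 < gcd k l" and k: "k = r * gcd k l" "0 < k"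
    and t: "2 < t" "odd t" "gcd k l \<le> t" and r: "5 \<le> r"
  shows "1 / t \<le> codegree_turan_density k (tight_cycle_minus k l)"
proof (rule density_ge_of_colour_pattern[where P = "colour_pattern r t"])
  show "0 < k" "k < l" "0 < t" using l k(2) t by simp_all
  show "\<exists>c<t. colour_pattern r t (add_mset c X)" if "size X = k - 1" "set_mset X \<subseteq> {..<t}" for X
  proof (rule colour_pattern_extend[OF t(2,1) _ _ t(3) _ that(2)])
    show "0 < r" using r by simp
    show "0 < gcd k l" using g by linarith
    show "size X = r * gcd k l - 1" unfolding k(1)[symmetric] by (rule that(1))
  qed
  show False if "\<And>n. Q n < t" "\<And>n. Q (n mod l) = Q n"
    "\<And>i. 1 \<le> i \<Longrightarrow> i < l \<Longrightarrow> colour_pattern r t (window Q i k)" for Q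
    by (rule colour_pattern_no_cycle[OF l g k t(1,2) r that])
qed

theorem theorem1p6:
  fixes k l p t :: nat
  assumes "3 \<le> k" and "k < l"
    and "\<not> [int l = 0] (mod int k)"
    and "\<not> [int l = 1] (mod int k)"
    and "\<not> [int l = - 1] (mod int k)"
    and "gcd k l > 1"
    and "p = (LEAST q. prime q \<and> q dvd k div gcd k l)"
    and "t = (LEAST s. odd s \<and> s \<ge> max 3 (gcd k l))"
  shows "codegree_turan_density k (tight_cycle_minus k l) \<ge> max (1 / real p) (1 / real t)"
proof -
  define g where "g = gcd k l"
  define r where "r = k div g"
  have g1: "1 < gcd k l" using assms(6) .
  have k: "k = r * gcd k l" "0 < k" using assms(1) by (simp_all add: r_def g_def)
  have "\<not> k dvd l" using assms(3) by (simp add: cong_0_iff)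
  then have "gcd k l \<noteq> k" by (metis gcd_dvd2)
  then have "r \<noteq> 1" using k(1) by auto
  then have "\<exists>q. prime q \<and> q dvd r" by (rule prime_factor_nat)
  then have p: "prime p" "p dvd r"
    using LeastI_ex[of "\<lambda>q. prime q \<and> q dvd r"] assms(7) by (simp_all add: r_def g_def)
  have "\<exists>s. odd s \<and> s \<ge> max 3 g" by (rule exI[of _ "2 * max 3 g + 1"]) (simp add: max_def)
  then have "odd t \<and> t \<ge> max 3 g" unfolding assms(8) g_def[symmetric] by (rule LeastI_ex)
  then have t: "odd t" "3 \<le> t" "gcd k l \<le> t" by (auto simp: g_def)
  have one: "1 / real p \<le> codegree_turan_density k (tight_cycle_minus k l)"
    using density_ge_inverse_factor[OF assms(2) g1 k prime_gt_1_nat[OF p(1)] p(2)] .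
  show ?thesis
  proof (cases "p \<le> t")
    case True
    then have "1 / real t \<le> 1 / real p" using prime_gt_0_nat[OF p(1)] by (intro divide_left_mono) auto
    then show ?thesis using one by simp
  next
    case False
    \<comment> \<open>From \<open>p > t \<ge> 3\<close> the prime \<open>p\<close> is at least \<open>5\<close>, which gives the bound on \<open>r\<close>.\<close>
    have "p \<noteq> 4" using prime_odd_nat[OF p(1)] by auto
    then have "5 \<le> p" using False t(2) by linarith
    moreover have "0 < r" using assms(1) k(1) by (cases "r = 0") auto
    then have "p \<le> r" using p(2) by (rule dvd_imp_le[rotated])
    ultimately have "5 \<le> r" by simp
    then have "1 / real t \<le> codegree_turan_density k (tight_cycle_minus k l)"
      using density_ge_inverse_odd[OF assms(2) g1 k _ t(1,3)] t(2) by simp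
    then show ?thesis using one by simp
  qed
qed

end
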